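(* Every modal FL-algebra $\mathbf{L}$ admits an isomorphic embedding (injective homomorphism of modal FL-algebras) into the modal FL-algebra $(\mathit{Prop}(\mathcal{S}),\subseteq,\otimes,1,\Rightarrow_l,\Rightarrow_r,0,!,?)$ of propositions of some strong modal FL-cover system $\mathcal{S}=(S,\preceq,\lhd,\cdot,\varepsilon,0,I,R)$, by an embedding that preserves all joins and meets existing in $\mathbf{L}$. Here strong means $X\otimes Y={\uparrow}(X\cdot Y)$ for all $X,Y\in\mathit{Prop}(\mathcal{S})$, and the operations are: $X\otimes Y=j{\uparrow}(X\cdot Y)$, $1={\uparrow}\varepsilon$, $X\Rightarrow_l Y=\{z:z\cdot X\subseteq Y\}$, $X\Rightarrow_r Y=\{z:X\cdot z\subseteq Y\}$, $!X=j{\uparrow}(X\cap I)$, $?X=\{x:\exists y\,(xRy,\ y\in X)\}$, meets are intersections and joins are $j$ of unions.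
   Context: Modal FL-algebras. A residuated lattice is $(L,\sqsubseteq,\otimes,1,\Rightarrow_l,\Rightarrow_r)$ with $(L,\sqsubseteq)$ a lattice, $(L,\otimes,1)$ a monoid with $\otimes$ monotone, and $a\sqsubseteq b\Rightarrow_l c$ iff $a\otimes b\sqsubseteq c$ iff $b\sqsubseteq a\Rightarrow_r c$. An FL-algebra is a residuated lattice with a distinguished element $0$. A modal FL-algebra is a bounded FL-algebra with unary operations $!,?$ such that for all $a,b$: (s1) $!a\sqsubseteq a$; (s2) $!a\sqsubseteq !!a$; (s3) $!1=1$; (s4) $!(a\sqcap b)=!a\otimes !b$; (s5) $!a\otimes b=b\otimes !a$; (c1) $!(a\Rightarrow_i b)\sqsubseteq ?a\Rightarrow_i ?b$ for $i=l,r$; (c2) $a\sqsubseteq ?a$; (c3) $??a\sqsubseteq ?a$; (c4) $?0\sqsubseteq 0$; (c5) $0\sqsubseteq ?a$. Cover systems. $(S,\preceq,\lhd)$: a set $S$, a preorder $\preceq$, and $\lhd\subseteq S\times\mathcal{P}(S)$. ${\uparrow}X=\{y:\exists x\in X,\ x\preceq y\}$, ${\uparrow}x={\uparrow}\{x\}$; up-sets satisfy ${\uparrow}X=X$. Cover system axioms: (Existence) each $x$ has a cover $C\subseteq{\uparrow}x$; (Transitivity) $x\lhd C$ and $y\lhd C_y$ for all $y\in C$ imply $x\lhd\bigcup_{y\in C}C_y$; (Refinement) $x\preceq y$ and $x\lhd C$ imply some $C'\subseteq{\uparrow}C$ with $y\lhd C'$. $jX=\{x:\exists C\,(x\lhd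 C\subseteq X)\}$; a proposition is an up-set $X$ with $jX\subseteq X$; $\mathit{Prop}(\mathcal{S})$ is the set of propositions. $X\cdot Y=\{x\cdot y:x\in X,y\in Y\}$, $x\cdot Y=\{x\}\cdot Y$. A residuated cover system $(S,\preceq,\lhd,\cdot,\varepsilon)$ is a cover system with an associative $\preceq$-monotone operation $\cdot$ with identity $\varepsilon$ such that $x\lhd C$ implies $x\cdot y\lhd C\cdot y$ and $y\cdot x\lhd y\cdot C$, and $x\lhd C\subseteq{\uparrow}\varepsilon$ implies $\varepsilon\preceq x$. A modal FL-cover system $(S,\preceq,\lhd,\cdot,\varepsilon,0,I,R)$ has $0\in\mathit{Prop}(\mathcal{S})$, $I\subseteq{\uparrow}\varepsilon$, $R\subseteq S\times S$, with: $(S,\preceq,\lhd,\cdot,\varepsilon)$ a residuated cover system; $I$ closed under $\cdot$ and $\varepsilon\in I$; $\varepsilon\lhd I$; each $x\in I$ has $x=x\cdot x$ and $x\cdot y=y\cdot x$ for all $y$; if $x\preceq y$ and $xRz$ then some $w$ has $z\preceq w$ and $yRw$; if some $x$-cover is included in $\langle R\rangle X=\{u:\exists v\,(uRv, v\in X)\}$ then some $y$ has $xRy$ and a $y$-cover included in $X$; $x\in I$ and $yRz$ imply $(x\cdot y)R(x\cdot z)$ and $(y\cdot x)R(z\cdot x)$; $R$ reflexive and transitive; $xRy\in 0$ implies $x\in0$; $x\in 0$ implies some $y$ with $xRy$ and $y\lhd\emptyset$. *)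

theory Defs
  imports "HOL-Algebra.Lattice" "HOL-Algebra.Coset"
begin

section \<open>Modal FL-algebras\<close>

record 'a residuated_lattice = "'a gorder" +
  tensor :: "['a, 'a] \<Rightarrow> 'a"  (infixl \<open>\<odot>\<index>\<close> 70)
  unit :: "'a"
  lres :: "['a, 'a] \<Rightarrow> 'a"  (infixr \<open>\<Rightarrow>\<^sub>l\<index>\<close> 66)
  rres :: "['a, 'a] \<Rightarrow> 'a"  (infixr \<open>\<Rightarrow>\<^sub>r\<index>\<close> 66)

record 'a FL_algebra = "'a residuated_lattice" +
  falsum :: "'a"

record 'a modal_FL_algebra = "'a FL_algebra" +
  bang :: "'a \<Rightarrow> 'a"
  quest :: "'a \<Rightarrow> 'a"

definition tensor_monoid :: "('a, 'm) residuated_lattice_scheme \<Rightarrow> 'a monoid" where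
  "tensor_monoid L = \<lparr>carrier = carrier L, mult = tensor L, one = unit L\<rparr>"

locale residuated_lattice = lattice L for L (structure) +
  assumes tensor_monoid: "monoid (tensor_monoid L)"
    and tensor_mono:
      "\<lbrakk>a \<in> carrier L; a' \<in> carrier L; b \<in> carrier L; b' \<in> carrier L; a \<sqsubseteq> a'; b \<sqsubseteq> b'\<rbrakk>
        \<Longrightarrow> a \<odot> b \<sqsubseteq> a' \<odot> b'"
    and lres_closed: "\<lbrakk>a \<in> carrier L; b \<in> carrier L\<rbrakk> \<Longrightarrow> a \<Rightarrow>\<^sub>l b \<in> carrier L"
    and rres_closed: "\<lbrakk>a \<in> carrier L; b \<in> carrier L\<rbrakk> \<Longrightarrow> a \<Rightarrow>\<^sub>r b \<in> carrier L"
    and lres: "\<lbrakk>a \<in> carrier L; b \<in> carrier L; c \<in> carrier L\<rbrakk>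
        \<Longrightarrow> a \<sqsubseteq> (b \<Rightarrow>\<^sub>l c) \<longleftrightarrow> a \<odot> b \<sqsubseteq> c"
    and rres: "\<lbrakk>a \<in> carrier L; b \<in> carrier L; c \<in> carrier L\<rbrakk>
        \<Longrightarrow> b \<sqsubseteq> (a \<Rightarrow>\<^sub>r c) \<longleftrightarrow> a \<odot> b \<sqsubseteq> c"

locale FL_algebra = residuated_lattice L for L (structure) +
  assumes falsum_closed: "falsum L \<in> carrier L"

locale modal_FL_algebra = FL_algebra L + bounded_lattice L for L (structure) +
  assumes bang_closed: "a \<in> carrier L \<Longrightarrow> bang L a \<in> carrier L"
    and quest_closed: "a \<in> carrier L \<Longrightarrow> quest L a \<in> carrier L"
    and s1: "a \<in> carrier L \<Longrightarrow> bang L a \<sqsubseteq> a"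
    and s2: "a \<in> carrier L \<Longrightarrow> bang L a \<sqsubseteq> bang L (bang L a)"
    and s3: "bang L (unit L) = unit L"
    and s4: "\<lbrakk>a \<in> carrier L; b \<in> carrier L\<rbrakk> \<Longrightarrow> bang L (a \<sqinter> b) = bang L a \<odot> bang L b"
    and s5: "\<lbrakk>a \<in> carrier L; b \<in> carrier L\<rbrakk> \<Longrightarrow> bang L a \<odot> b = b \<odot> bang L a"
    and c1_l: "\<lbrakk>a \<in> carrier L; b \<in> carrier L\<rbrakk>
        \<Longrightarrow> bang L (a \<Rightarrow>\<^sub>l b) \<sqsubseteq> (quest L a \<Rightarrow>\<^sub>l quest L b)"
    and c1_r: "\<lbrakk>a \<in> carrier L; b \<in> carrier L\<rbrakk>
        \<Longrightarrow> bang L (a \<Rightarrow>\<^sub>r b) \<sqsubseteq> (quest L a \<Rightarrow>\<^sub>r quest L b)"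
    and c2: "a \<in> carrier L \<Longrightarrow> a \<sqsubseteq> quest L a"
    and c3: "a \<in> carrier L \<Longrightarrow> quest L (quest L a) \<sqsubseteq> quest L a"
    and c4: "quest L (falsum L) \<sqsubseteq> falsum L"
    and c5: "a \<in> carrier L \<Longrightarrow> falsum L \<sqsubseteq> quest L a"

definition modal_FL_hom ::
  "('a, 'm) modal_FL_algebra_scheme \<Rightarrow> ('b, 'n) modal_FL_algebra_scheme \<Rightarrow> ('a \<Rightarrow> 'b) set" where
  "modal_FL_hom L M = {f. f \<in> carrier L \<rightarrow> carrier M
     \<and> (\<forall>a\<in>carrier L. \<forall>b\<in>carrier L.
          f (a \<squnion>\<^bsub>L\<^esub> b) = f a \<squnion>\<^bsub>M\<^esub> f b
        \<and> f (a \<sqinter>\<^bsub>L\<^esub> b) = f a \<sqinter>\<^bsub>M\<^esub> f b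
        \<and> f (a \<odot>\<^bsub>L\<^esub> b) = f a \<odot>\<^bsub>M\<^esub> f b
        \<and> f (a \<Rightarrow>\<^sub>l\<^bsub>L\<^esub> b) = f a \<Rightarrow>\<^sub>l\<^bsub>M\<^esub> f b
        \<and> f (a \<Rightarrow>\<^sub>r\<^bsub>L\<^esub> b) = f a \<Rightarrow>\<^sub>r\<^bsub>M\<^esub> f b)
     \<and> (\<forall>a\<in>carrier L. f (bang L a) = bang M (f a) \<and> f (quest L a) = quest M (f a))
     \<and> f \<top>\<^bsub>L\<^esub> = \<top>\<^bsub>M\<^esub> \<and> f \<bottom>\<^bsub>L\<^esub> = \<bottom>\<^bsub>M\<^esub>
     \<and> f (unit L) = unit M \<and> f (falsum L) = falsum M}"

definition preserves_joins ::
  "('a, 'm) gorder_scheme \<Rightarrow> ('b, 'n) gorder_scheme \<Rightarrow> ('a \<Rightarrow> 'b) \<Rightarrow> bool" where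
  "preserves_joins L M f \<longleftrightarrow>
     (\<forall>A a. A \<subseteq> carrier L \<longrightarrow> is_lub L a A \<longrightarrow> is_lub M (f a) (f ` A))"

definition preserves_meets ::
  "('a, 'm) gorder_scheme \<Rightarrow> ('b, 'n) gorder_scheme \<Rightarrow> ('a \<Rightarrow> 'b) \<Rightarrow> bool" where
  "preserves_meets L M f \<longleftrightarrow>
     (\<forall>A a. A \<subseteq> carrier L \<longrightarrow> is_glb L a A \<longrightarrow> is_glb M (f a) (f ` A))"


section \<open>Modal FL-cover systems\<close>

text \<open>
  The carrier, the operation \<open>\<cdot>\<close> and its identity \<open>\<epsilon>\<close> are the fields of \<^typ>\<open>'s monoid\<close>; the
  products \<open>X \<cdot> Y\<close>, \<open>x \<cdot> Y\<close> and \<open>X \<cdot> y\<close> are \<open>X <#> Y\<close>, \<open>x <# Y\<close> and \<open>X #> y\<close>.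
  A pair \<open>(x, C)\<close> in \<open>covers\<close> means that \<open>C\<close> covers \<open>x\<close>.
\<close>

record 's modal_FL_cover_system = "'s monoid" +
  preord :: "('s \<times> 's) set"
  covers :: "('s \<times> 's set) set"
  czero :: "'s set"
  idem :: "'s set"
  access :: "('s \<times> 's) set"

definition upset :: "('s, 'm) modal_FL_cover_system_scheme \<Rightarrow> 's set \<Rightarrow> 's set" where
  "upset S X = preord S `` X"

definition j :: "('s, 'm) modal_FL_cover_system_scheme \<Rightarrow> 's set \<Rightarrow> 's set" where
  "j S X = {x \<in> carrier S. \<exists>C. (x, C) \<in> covers S \<and> C \<subseteq> X}"

definition Prop :: "('s, 'm) modal_FL_cover_system_scheme \<Rightarrow> 's set set" where
  "Prop S = {X. X \<subseteq> carrier S \<and> upset S X = X \<and> j S X \<subseteq> X}"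

definition diamond :: "('s, 'm) modal_FL_cover_system_scheme \<Rightarrow> 's set \<Rightarrow> 's set" where
  "diamond S X = {x \<in> carrier S. \<exists>y. (x, y) \<in> access S \<and> y \<in> X}"

locale cover_system =
  fixes S :: "('s, 'm) modal_FL_cover_system_scheme" (structure)
  assumes preorder: "preorder_on (carrier S) (preord S)"
    and covers_closed: "covers S \<subseteq> carrier S \<times> Pow (carrier S)"
    and existence: "x \<in> carrier S \<Longrightarrow> \<exists>C. (x, C) \<in> covers S \<and> C \<subseteq> upset S {x}"
    and transitivity: "\<lbrakk>(x, C) \<in> covers S; \<And>y. y \<in> C \<Longrightarrow> (y, D y) \<in> covers S\<rbrakk>
        \<Longrightarrow> (x, \<Union>y\<in>C. D y) \<in> covers S"
    and refinement: "\<lbrakk>(x, y) \<in> preord S; (x, C) \<in> covers S\<rbrakk>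
        \<Longrightarrow> \<exists>C'. C' \<subseteq> upset S C \<and> (y, C') \<in> covers S"

locale residuated_cover_system = cover_system S + monoid S
  for S :: "('s, 'm) modal_FL_cover_system_scheme" (structure) +
  assumes mult_mono: "\<lbrakk>(x, x') \<in> preord S; (y, y') \<in> preord S\<rbrakk>
        \<Longrightarrow> (x \<otimes> y, x' \<otimes> y') \<in> preord S"
    and covers_mult_right: "\<lbrakk>(x, C) \<in> covers S; y \<in> carrier S\<rbrakk> \<Longrightarrow> (x \<otimes> y, C #> y) \<in> covers S"
    and covers_mult_left: "\<lbrakk>(x, C) \<in> covers S; y \<in> carrier S\<rbrakk> \<Longrightarrow> (y \<otimes> x, y <# C) \<in> covers S"
    and covers_one: "\<lbrakk>(x, C) \<in> covers S; C \<subseteq> upset S {\<one>}\<rbrakk> \<Longrightarrow> (\<one>, x) \<in> preord S"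

locale modal_FL_cover_system = residuated_cover_system S
  for S :: "('s, 'm) modal_FL_cover_system_scheme" (structure) +
  assumes czero_Prop: "czero S \<in> Prop S"
    and idem_subset: "idem S \<subseteq> upset S {\<one>}"
    and access_subset: "access S \<subseteq> carrier S \<times> carrier S"
    and idem_mult: "\<lbrakk>x \<in> idem S; y \<in> idem S\<rbrakk> \<Longrightarrow> x \<otimes> y \<in> idem S"
    and idem_one: "\<one> \<in> idem S"
    and one_covers_idem: "(\<one>, idem S) \<in> covers S"
    and idem_idempotent: "x \<in> idem S \<Longrightarrow> x = x \<otimes> x"
    and idem_central: "\<lbrakk>x \<in> idem S; y \<in> carrier S\<rbrakk> \<Longrightarrow> x \<otimes> y = y \<otimes> x"
    and access_confluent: "\<lbrakk>(x, y) \<in> preord S; (x, z) \<in> access S\<rbrakk>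
        \<Longrightarrow> \<exists>w. (z, w) \<in> preord S \<and> (y, w) \<in> access S"
    and access_local: "\<lbrakk>X \<subseteq> carrier S; (x, C) \<in> covers S; C \<subseteq> diamond S X\<rbrakk>
        \<Longrightarrow> \<exists>y D. (x, y) \<in> access S \<and> (y, D) \<in> covers S \<and> D \<subseteq> X"
    and access_mult_left: "\<lbrakk>x \<in> idem S; (y, z) \<in> access S\<rbrakk> \<Longrightarrow> (x \<otimes> y, x \<otimes> z) \<in> access S"
    and access_mult_right: "\<lbrakk>x \<in> idem S; (y, z) \<in> access S\<rbrakk> \<Longrightarrow> (y \<otimes> x, z \<otimes> x) \<in> access S"
    and access_refl: "refl_on (carrier S) (access S)"
    and access_trans: "trans (access S)"
    and access_czero: "\<lbrakk>(x, y) \<in> access S; y \<in> czero S\<rbrakk> \<Longrightarrow> x \<in> czero S"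
    and czero_access: "x \<in> czero S \<Longrightarrow> \<exists>y. (x, y) \<in> access S \<and> (y, {}) \<in> covers S"

definition strong :: "('s, 'm) modal_FL_cover_system_scheme \<Rightarrow> bool" where
  "strong S \<longleftrightarrow> (\<forall>X\<in>Prop S. \<forall>Y\<in>Prop S.
     j S (upset S (X <#>\<^bsub>S\<^esub> Y)) = upset S (X <#>\<^bsub>S\<^esub> Y))"

definition Prop_algebra ::
  "('s, 'm) modal_FL_cover_system_scheme \<Rightarrow> 's set modal_FL_algebra" where
  "Prop_algebra S =
     \<lparr>carrier = Prop S,
      eq = (=),
      le = (\<subseteq>),
      tensor = (\<lambda>X Y. j S (upset S (X <#>\<^bsub>S\<^esub> Y))),
      unit = upset S {\<one>\<^bsub>S\<^esub>},
      lres = (\<lambda>X Y. {z \<in> carrier S. z <#\<^bsub>S\<^esub> X \<subseteq> Y}),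
      rres = (\<lambda>X Y. {z \<in> carrier S. X #>\<^bsub>S\<^esub> z \<subseteq> Y}),
      falsum = czero S,
      bang = (\<lambda>X. j S (upset S (X \<inter> idem S))),
      quest = diamond S\<rparr>"

end

theory Submission
  imports Defs "HOL-Algebra.Complete_Lattice"
begin

text \<open>
  The normal sets (the sets \<open>X\<close> consisting of all lower bounds of the upper bounds of \<open>X\<close>) form a
  complete modal FL-algebra \<open>M\<close>, with \<open>!X\<close> generated by the \<open>!a\<close> for \<open>a \<in> X\<close>, and \<open>?X\<close> consisting of
  the lower bounds of the \<open>?b\<close> for upper bounds \<open>b\<close> of \<open>X\<close>; sending \<open>a\<close> to its principal down-set
  embeds \<open>L\<close> and preserves existing joins and meets. A complete modal FL-algebra is itself a modal
  FL-cover system under the reversed order, with \<open>x\<close> covered by \<open>C\<close> iff \<open>x\<close> lies in the normal set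
  generated by \<open>C\<close>, with \<open>I\<close> the range of \<open>!\<close>, and with \<open>x R y\<close> iff \<open>x \<sqsubseteq> ?y\<close>. Its propositions are
  exactly the normal sets, so the same completion theorem, now applied to \<open>M\<close>, describes the algebra
  of propositions; completeness makes every normal set principal, whence strength.
\<close>

section \<open>Modal FL-algebras\<close>

context residuated_lattice
begin

lemma tensor_closed [simp]: "\<lbrakk>a \<in> carrier L; b \<in> carrier L\<rbrakk> \<Longrightarrow> a \<odot> b \<in> carrier L"
  using monoid.m_closed [OF tensor_monoid] by (simp add: tensor_monoid_def)

lemma unit_closed [simp]: "unit L \<in> carrier L"
  using monoid.one_closed [OF tensor_monoid] by (simp add: tensor_monoid_def)

lemma unit_tensor [simp]: "a \<in> carrier L \<Longrightarrow> unit L \<odot> a = a"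
  using monoid.l_one [OF tensor_monoid] by (simp add: tensor_monoid_def)

lemma tensor_unit [simp]: "a \<in> carrier L \<Longrightarrow> a \<odot> unit L = a"
  using monoid.r_one [OF tensor_monoid] by (simp add: tensor_monoid_def)

lemma tensor_assoc:
  "\<lbrakk>a \<in> carrier L; b \<in> carrier L; c \<in> carrier L\<rbrakk> \<Longrightarrow> (a \<odot> b) \<odot> c = a \<odot> (b \<odot> c)"
  using monoid.m_assoc [OF tensor_monoid] by (simp add: tensor_monoid_def)

lemmas res_closed [simp] = lres_closed rres_closed

end

context modal_FL_algebra
begin

lemmas modal_closed [simp] = bang_closed quest_closed falsum_closed

text \<open>By (s4) and (s3), \<open>bang L (a \<sqinter> unit L)\<close> is
  \<open>bang L a \<odot> unit L\<close>, that is \<open>bang L a\<close>; (s1) then puts it below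
  the meet.\<close>

lemma bang_le_unit:
  assumes "a \<in> carrier L"
  shows "bang L a \<sqsubseteq> unit L"
proof -
  have "bang L a = bang L (a \<sqinter> unit L)"
    using assms by (simp add: s4 s3)
  also have "\<dots> \<sqsubseteq> a \<sqinter> unit L"
    using assms by (simp add: s1)
  finally show ?thesis
    using assms meet_right [of a "unit L"] le_trans by (meson meet_closed modal_closed(1) unit_closed)
qed

text \<open>Monotonicity is hidden in (s4): if \<open>a \<sqsubseteq> b\<close> then the meet is
  \<open>a\<close>, so \<open>bang L a\<close> equals \<open>bang L a \<odot> bang L b\<close>, and
  the first factor is below the unit.\<close>

lemma bang_mono:
  assumes "a \<in> carrier L" "b \<in> carrier L" "a \<sqsubseteq> b"
  shows "bang L a \<sqsubseteq> bang L b"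
proof -
  have "bang L a = bang L a \<odot> bang L b"
    using assms le_iff_join [of a b] s4 [of a b] by simp
  also have "\<dots> \<sqsubseteq> unit L \<odot> bang L b"
    using assms by (intro tensor_mono) (auto intro: bang_le_unit)
  finally show ?thesis using assms by simp
qed

lemma bang_idem: "a \<in> carrier L \<Longrightarrow> bang L (bang L a) = bang L a"
  using s1 [of "bang L a"] s2 [of a] by (simp add: le_antisym)

lemma bang_tensor_bang: "a \<in> carrier L \<Longrightarrow> bang L a \<odot> bang L a = bang L a"
  using s4 [of a a] le_iff_join [of a a] by simp

text \<open>An inequality is the statement that the unit lies below a residual. By (s3) the unit
  survives \<open>bang L\<close>, and (c1) moves it to the residual of the images.\<close>

lemma quest_mono:
  assumes "a \<in> carrier L" "b \<in> carrier L" "a \<sqsubseteq> b"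
  shows "quest L a \<sqsubseteq> quest L b"
proof -
  have "unit L \<sqsubseteq> a \<Rightarrow>\<^sub>l b"
    using assms by (simp add: lres)
  then have "unit L \<sqsubseteq> bang L (a \<Rightarrow>\<^sub>l b)"
    using assms bang_mono [of "unit L" "a \<Rightarrow>\<^sub>l b"] by (simp add: s3)
  also have "\<dots> \<sqsubseteq> quest L a \<Rightarrow>\<^sub>l quest L b"
    using assms by (simp add: c1_l)
  finally show ?thesis
    using assms by (simp add: lres)
qed

lemma quest_idem: "a \<in> carrier L \<Longrightarrow> quest L (quest L a) = quest L a"
  by (simp add: le_antisym c2 c3)

text \<open>This is (c1) recast for arguments by upper bounds: it is applied to the residual
  \<open>z \<Rightarrow>\<^sub>r b\<close>, since \<open>z\<close> lies below the double residual
  \<open>(z \<Rightarrow>\<^sub>r b) \<Rightarrow>\<^sub>l b\<close>. It yields both (c1) in the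
  completion and the compatibility of \<open>access\<close> with multiplication by
  \<open>idem\<close>.\<close>

lemma bang_tensor_quest:
  assumes "z \<in> carrier L" "w \<in> carrier L" "b \<in> carrier L" "w \<sqsubseteq> quest L (z \<Rightarrow>\<^sub>r b)"
  shows "bang L z \<odot> w \<sqsubseteq> quest L b"
proof -
  have "z \<sqsubseteq> (z \<Rightarrow>\<^sub>r b) \<Rightarrow>\<^sub>l b"
    using assms by (simp add: lres rres [symmetric])
  then have "bang L z \<sqsubseteq> bang L ((z \<Rightarrow>\<^sub>r b) \<Rightarrow>\<^sub>l b)"
    using assms by (simp add: bang_mono)
  also have "\<dots> \<sqsubseteq> quest L (z \<Rightarrow>\<^sub>r b) \<Rightarrow>\<^sub>l quest L b"
    using assms by (simp add: c1_l)
  finally have "bang L z \<odot> quest L (z \<Rightarrow>\<^sub>r b) \<sqsubseteq> quest L b"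
    using assms by (simp add: lres)
  moreover have "bang L z \<odot> w \<sqsubseteq> bang L z \<odot> quest L (z \<Rightarrow>\<^sub>r b)"
    using assms by (intro tensor_mono) auto
  ultimately show ?thesis
    using assms le_trans [of "bang L z \<odot> w" "bang L z \<odot> quest L (z \<Rightarrow>\<^sub>r b)"] by simp
qed

lemma tensor_quest_bang:
  assumes "z \<in> carrier L" "w \<in> carrier L" "b \<in> carrier L" "w \<sqsubseteq> quest L (z \<Rightarrow>\<^sub>l b)"
  shows "w \<odot> bang L z \<sqsubseteq> quest L b"
proof -
  have "z \<sqsubseteq> (z \<Rightarrow>\<^sub>l b) \<Rightarrow>\<^sub>r b"
    using assms by (simp add: rres lres [symmetric])
  then have "bang L z \<sqsubseteq> bang L ((z \<Rightarrow>\<^sub>l b) \<Rightarrow>\<^sub>r b)"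
    using assms by (simp add: bang_mono)
  also have "\<dots> \<sqsubseteq> quest L (z \<Rightarrow>\<^sub>l b) \<Rightarrow>\<^sub>r quest L b"
    using assms by (simp add: c1_r)
  finally have "quest L (z \<Rightarrow>\<^sub>l b) \<odot> bang L z \<sqsubseteq> quest L b"
    using assms by (simp add: rres)
  moreover have "w \<odot> bang L z \<sqsubseteq> quest L (z \<Rightarrow>\<^sub>l b) \<odot> bang L z"
    using assms by (intro tensor_mono) auto
  ultimately show ?thesis
    using assms le_trans [of "w \<odot> bang L z" "quest L (z \<Rightarrow>\<^sub>l b) \<odot> bang L z"] by simp
qed

end

section \<open>Homomorphisms and maps preserving joins and meets\<close>

text \<open>The lattice clauses come for free: binary joins and meets are bounds of a pair, and the
  top and bottom are the meet and join of the empty set.\<close>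

lemma modal_FL_hom_if_preserves:
  assumes "modal_FL_algebra L" "modal_FL_algebra M" "f \<in> carrier L \<rightarrow> carrier M"
    and joins: "preserves_joins L M f" and meets: "preserves_meets L M f"
    and "\<And>a b. \<lbrakk>a \<in> carrier L; b \<in> carrier L\<rbrakk> \<Longrightarrow> f (a \<odot>\<^bsub>L\<^esub> b) = f a \<odot>\<^bsub>M\<^esub> f b"
    and "\<And>a b. \<lbrakk>a \<in> carrier L; b \<in> carrier L\<rbrakk> \<Longrightarrow> f (a \<Rightarrow>\<^sub>l\<^bsub>L\<^esub> b) = f a \<Rightarrow>\<^sub>l\<^bsub>M\<^esub> f b"
    and "\<And>a b. \<lbrakk>a \<in> carrier L; b \<in> carrier L\<rbrakk> \<Longrightarrow> f (a \<Rightarrow>\<^sub>r\<^bsub>L\<^esub> b) = f a \<Rightarrow>\<^sub>r\<^bsub>M\<^esub> f b"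
    and "\<And>a. a \<in> carrier L \<Longrightarrow> f (bang L a) = bang M (f a)"
    and "\<And>a. a \<in> carrier L \<Longrightarrow> f (quest L a) = quest M (f a)"
    and "f (unit L) = unit M" "f (falsum L) = falsum M"
  shows "f \<in> modal_FL_hom L M"
proof -
  interpret L: modal_FL_algebra L by fact
  interpret M: modal_FL_algebra M by fact
  have f: "f a \<in> carrier M" if "a \<in> carrier L" for a
    using assms(3) that by blast
  have "f (a \<squnion>\<^bsub>L\<^esub> b) = f a \<squnion>\<^bsub>M\<^esub> f b" if "a \<in> carrier L" "b \<in> carrier L" for a b
  proof -
    have "is_lub L (a \<squnion>\<^bsub>L\<^esub> b) {a, b}"
      using that by (simp add: L.sup_of_two_least join_def)
    then have "is_lub M (f (a \<squnion>\<^bsub>L\<^esub> b)) {f a, f b}"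
      using joins that unfolding preserves_joins_def by (force dest!: spec [of _ "{a, b}"])
    moreover have "is_lub M (f a \<squnion>\<^bsub>M\<^esub> f b) {f a, f b}"
      using that f by (simp add: M.sup_of_two_least join_def)
    ultimately show ?thesis by (rule M.least_unique)
  qed
  moreover have "f (a \<sqinter>\<^bsub>L\<^esub> b) = f a \<sqinter>\<^bsub>M\<^esub> f b" if "a \<in> carrier L" "b \<in> carrier L" for a b
  proof -
    have "is_glb L (a \<sqinter>\<^bsub>L\<^esub> b) {a, b}"
      using that by (simp add: L.inf_of_two_greatest meet_def)
    then have "is_glb M (f (a \<sqinter>\<^bsub>L\<^esub> b)) {f a, f b}"
      using meets that unfolding preserves_meets_def by (force dest!: spec [of _ "{a, b}"])
    moreover have "is_glb M (f a \<sqinter>\<^bsub>M\<^esub> f b) {f a, f b}"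
      using that f by (simp add: M.inf_of_two_greatest meet_def)
    ultimately show ?thesis by (rule M.greatest_unique)
  qed
  moreover have "f \<top>\<^bsub>L\<^esub> = \<top>\<^bsub>M\<^esub>"
  proof -
    have "is_glb M (f \<top>\<^bsub>L\<^esub>) {}"
      using meets L.top_greatest unfolding preserves_meets_def by (force dest!: spec [of _ "{}"])
    then show ?thesis
      using M.top_greatest M.greatest_unique by fastforce
  qed
  moreover have "f \<bottom>\<^bsub>L\<^esub> = \<bottom>\<^bsub>M\<^esub>"
  proof -
    have "is_lub M (f \<bottom>\<^bsub>L\<^esub>) {}"
      using joins L.bottom_least unfolding preserves_joins_def by (force dest!: spec [of _ "{}"])
    then show ?thesis
      using M.bottom_least M.least_unique by fastforce
  qed
  ultimately show ?thesis
    using assms unfolding modal_FL_hom_def by simp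
qed

lemma modal_FL_hom_comp:
  assumes "f \<in> modal_FL_hom L M" "g \<in> modal_FL_hom M N"
  shows "g \<circ> f \<in> modal_FL_hom L N"
  using assms by (auto simp: modal_FL_hom_def Pi_iff)

lemma preserves_joins_comp:
  assumes "preserves_joins L M f" "preserves_joins M N g" "f \<in> carrier L \<rightarrow> carrier M"
  shows "preserves_joins L N (g \<circ> f)"
  unfolding preserves_joins_def
proof (intro allI impI)
  fix A a assume A: "A \<subseteq> carrier L" "is_lub L a A"
  then have "is_lub M (f a) (f ` A)" "f ` A \<subseteq> carrier M"
    using assms unfolding preserves_joins_def by auto
  then show "is_lub N ((g \<circ> f) a) ((g \<circ> f) ` A)"
    using assms(2) unfolding preserves_joins_def by (simp add: image_image [symmetric, of g f])
qed

lemma preserves_meets_comp: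
  assumes "preserves_meets L M f" "preserves_meets M N g" "f \<in> carrier L \<rightarrow> carrier M"
  shows "preserves_meets L N (g \<circ> f)"
  unfolding preserves_meets_def
proof (intro allI impI)
  fix A a assume A: "A \<subseteq> carrier L" "is_glb L a A"
  then have "is_glb M (f a) (f ` A)" "f ` A \<subseteq> carrier M"
    using assms unfolding preserves_meets_def by auto
  then show "is_glb N ((g \<circ> f) a) ((g \<circ> f) ` A)"
    using assms(2) unfolding preserves_meets_def by (simp add: image_image [symmetric, of g f])
qed

section \<open>The MacNeille completion\<close>

definition closure :: "('a, 'm) gorder_scheme \<Rightarrow> 'a set \<Rightarrow> 'a set" where
  "closure L X = Lower L (Upper L X)"

text \<open>One inclusion is enough, as the other holds for every subset of the carrier; the shape
  matches the condition \<open>j S X \<subseteq> X\<close> on propositions.\<close>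

definition normal_sets :: "('a, 'm) gorder_scheme \<Rightarrow> 'a set set" where
  "normal_sets L = {X. X \<subseteq> carrier L \<and> closure L X \<subseteq> X}"

definition down :: "('a, 'm) gorder_scheme \<Rightarrow> 'a \<Rightarrow> 'a set" where
  "down L a = {x \<in> carrier L. x \<sqsubseteq>\<^bsub>L\<^esub> a}"

context partial_order
begin

lemma mem_closure_iff:
  assumes "X \<subseteq> carrier L"
  shows "x \<in> closure L X \<longleftrightarrow>
    x \<in> carrier L \<and> (\<forall>u\<in>carrier L. (\<forall>y\<in>X. y \<sqsubseteq> u) \<longrightarrow> x \<sqsubseteq> u)"
proof -
  have "X \<inter> carrier L = X"
    using assms by blast
  then show ?thesis
    unfolding closure_def Upper_def Lower_def by (auto simp: set_eq_iff)
qed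

lemma closure_closed: "closure L X \<subseteq> carrier L"
  by (auto simp: closure_def)

lemma subset_closure: "X \<subseteq> carrier L \<Longrightarrow> X \<subseteq> closure L X"
  by (auto simp: mem_closure_iff)

lemma closure_mono: "X \<subseteq> Y \<Longrightarrow> closure L X \<subseteq> closure L Y"
  by (simp add: closure_def Lower_antimono Upper_antimono)

lemma closure_closure: "X \<subseteq> carrier L \<Longrightarrow> closure L (closure L X) = closure L X"
  by (auto simp: mem_closure_iff closure_closed)

lemma normal_setsD: "X \<in> normal_sets L \<Longrightarrow> x \<in> X \<Longrightarrow> x \<in> carrier L"
  by (auto simp: normal_sets_def)

lemma normal_sets_subset: "X \<in> normal_sets L \<Longrightarrow> X \<subseteq> carrier L"
  by (simp add: normal_sets_def)

lemma normal_setsI: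
  assumes "X \<subseteq> carrier L"
    and "\<And>x. \<lbrakk>x \<in> carrier L; \<And>u. \<lbrakk>u \<in> carrier L; \<And>y. y \<in> X \<Longrightarrow> y \<sqsubseteq> u\<rbrakk> \<Longrightarrow> x \<sqsubseteq> u\<rbrakk> \<Longrightarrow> x \<in> X"
  shows "X \<in> normal_sets L"
  using assms by (auto simp: normal_sets_def mem_closure_iff)

lemma normal_sets_mem:
  assumes "X \<in> normal_sets L" "x \<in> carrier L"
    and "\<And>u. \<lbrakk>u \<in> carrier L; \<And>y. y \<in> X \<Longrightarrow> y \<sqsubseteq> u\<rbrakk> \<Longrightarrow> x \<sqsubseteq> u"
  shows "x \<in> X"
  using assms by (auto simp: normal_sets_def mem_closure_iff)

lemma normal_sets_down_closed:
  assumes "X \<in> normal_sets L" "y \<in> X" "x \<in> carrier L" "x \<sqsubseteq> y"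
  shows "x \<in> X"
  using assms by (auto intro!: normal_sets_mem [OF assms(1)] intro: le_trans dest: normal_setsD)

lemma down_subset_normal: "\<lbrakk>X \<in> normal_sets L; a \<in> X\<rbrakk> \<Longrightarrow> down L a \<subseteq> X"
  unfolding down_def using normal_sets_down_closed [of X a] by blast

lemma closure_normal: "X \<in> normal_sets L \<Longrightarrow> closure L X = X"
  using subset_closure by (auto simp: normal_sets_def)

lemma closure_in_normal_sets: "X \<subseteq> carrier L \<Longrightarrow> closure L X \<in> normal_sets L"
  by (simp add: normal_sets_def closure_closed closure_closure)

lemma closure_subset_iff:
  assumes "X \<subseteq> carrier L" "Y \<in> normal_sets L"
  shows "closure L X \<subseteq> Y \<longleftrightarrow> X \<subseteq> Y"
  using subset_closure [OF assms(1)] closure_mono [of X Y] closure_normal [OF assms(2)] by auto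

lemma down_in_normal_sets: "a \<in> carrier L \<Longrightarrow> down L a \<in> normal_sets L"
  by (rule normal_setsI) (auto simp: down_def)

lemma down_subset_iff: "\<lbrakk>a \<in> carrier L; b \<in> carrier L\<rbrakk> \<Longrightarrow> down L a \<subseteq> down L b \<longleftrightarrow> a \<sqsubseteq> b"
  by (auto simp: down_def intro: le_trans)

lemma down_inj: "inj_on (down L) (carrier L)"
  by (rule inj_onI) (metis down_subset_iff le_antisym order_refl)

lemma down_eq_closure: "a \<in> carrier L \<Longrightarrow> down L a = closure L {a}"
  by (auto simp: down_def mem_closure_iff intro: le_trans)

text \<open>Each member contains whatever is below all upper bounds of the intersection. Cutting
  down to the carrier covers the empty family, whose intersection is the whole type.\<close>

lemma Inter_normal_sets:
  assumes "\<X> \<subseteq> normal_sets L"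
  shows "carrier L \<inter> \<Inter>\<X> \<in> normal_sets L"
proof (rule normal_setsI)
  fix x assume x: "x \<in> carrier L"
    "\<And>u. \<lbrakk>u \<in> carrier L; \<And>y. y \<in> carrier L \<inter> \<Inter>\<X> \<Longrightarrow> y \<sqsubseteq> u\<rbrakk> \<Longrightarrow> x \<sqsubseteq> u"
  then show "x \<in> carrier L \<inter> \<Inter>\<X>"
    using assms by (auto intro!: normal_sets_mem)
qed auto

end

section \<open>Closure in the presence of completeness, tensor and modalities\<close>

text \<open>The join of \<open>X\<close> is below every upper bound of \<open>X\<close>, so
  normality puts it into \<open>X\<close>, where it is the greatest element.\<close>

lemma (in complete_lattice) normal_set_eq_down:
  assumes "X \<in> normal_sets L"
  obtains a where "a \<in> carrier L" "X = down L a"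
proof -
  obtain s where s: "is_lub L s X"
    using sup_exists normal_sets_subset [OF assms] by blast
  then have sc: "s \<in> carrier L" by blast
  have "s \<in> X"
    using s sc by (intro normal_sets_mem [OF assms]) (blast intro: least_le [OF s] Upper_memI)+
  moreover have "x \<sqsubseteq> s" if "x \<in> X" for x
    using least_Upper_above [OF s that] normal_sets_subset [OF assms] by simp
  ultimately have "X = down L s"
    using down_subset_normal [OF assms] normal_setsD [OF assms] by (auto simp: down_def)
  with sc show thesis by (rule that)
qed

lemma (in residuated_lattice) tensor_set_closed:
  "\<lbrakk>X \<subseteq> carrier L; Y \<subseteq> carrier L\<rbrakk> \<Longrightarrow> X <#>\<^bsub>tensor_monoid L\<^esub> Y \<subseteq> carrier L"
  by (auto simp: set_mult_def tensor_monoid_def subset_iff)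

text \<open>Closure is a nucleus: residuation moves one factor at a time to the upper bound.\<close>

lemma (in residuated_lattice) tensor_mem_closure:
  assumes X: "X \<subseteq> carrier L" and Y: "Y \<subseteq> carrier L"
    and x: "x \<in> closure L X" and y: "y \<in> closure L Y"
  shows "x \<odot> y \<in> closure L (X <#>\<^bsub>tensor_monoid L\<^esub> Y)"
proof -
  have xc: "x \<in> carrier L" and yc: "y \<in> carrier L"
    using x y closure_closed by auto
  have "x \<odot> y \<sqsubseteq> u" if u: "u \<in> carrier L"
    and le: "\<And>a b. \<lbrakk>a \<in> X; b \<in> Y\<rbrakk> \<Longrightarrow> a \<odot> b \<sqsubseteq> u" for u
  proof -
    have "x \<odot> b \<sqsubseteq> u" if "b \<in> Y" for b
    proof -
      have b: "b \<in> carrier L" using that Y by auto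
      have "\<forall>a\<in>X. a \<sqsubseteq> b \<Rightarrow>\<^sub>l u"
        using le that X u b by (auto simp: lres subset_iff)
      then have "x \<sqsubseteq> b \<Rightarrow>\<^sub>l u"
        using x u X b by (simp add: mem_closure_iff)
      then show ?thesis
        using xc u b by (simp add: lres)
    qed
    then have "\<forall>b\<in>Y. b \<sqsubseteq> x \<Rightarrow>\<^sub>r u"
      using Y xc u by (auto simp: rres subset_iff)
    then have "y \<sqsubseteq> x \<Rightarrow>\<^sub>r u"
      using y u xc Y by (simp add: mem_closure_iff)
    then show ?thesis
      using xc yc u by (simp add: rres)
  qed
  then show ?thesis
    using xc yc unfolding mem_closure_iff [OF tensor_set_closed [OF X Y]]
    by (auto simp: set_mult_def tensor_monoid_def)
qed

text \<open>Generating sets may therefore be multiplied in place of their closures. Associativity,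
  the unit laws and the laws of \<open>!\<close> in the completion are all computed in this
  way.\<close>

lemma (in residuated_lattice) closure_tensor_closure:
  assumes X: "X \<subseteq> carrier L" and Y: "Y \<subseteq> carrier L"
  shows "closure L (closure L X <#>\<^bsub>tensor_monoid L\<^esub> closure L Y) = closure L (X <#>\<^bsub>tensor_monoid L\<^esub> Y)"
proof
  have "closure L X <#>\<^bsub>tensor_monoid L\<^esub> closure L Y \<subseteq> closure L (X <#>\<^bsub>tensor_monoid L\<^esub> Y)"
    using tensor_mem_closure [OF X Y] by (auto simp: set_mult_def tensor_monoid_def)
  then show "closure L (closure L X <#>\<^bsub>tensor_monoid L\<^esub> closure L Y) \<subseteq> closure L (X <#>\<^bsub>tensor_monoid L\<^esub> Y)"
    by (simp add: closure_subset_iff closure_in_normal_sets tensor_set_closed X Y closure_closed)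
  show "closure L (X <#>\<^bsub>tensor_monoid L\<^esub> Y) \<subseteq> closure L (closure L X <#>\<^bsub>tensor_monoid L\<^esub> closure L Y)"
    by (intro closure_mono mono_set_mult subset_closure X Y)
qed

lemma (in modal_FL_algebra) bang_mem_normal:
  assumes "X \<in> normal_sets L" "x \<in> X"
  shows "bang L x \<in> X"
  using normal_sets_down_closed [OF assms bang_closed s1] normal_setsD [OF assms] by simp

text \<open>By monotonicity \<open>bang L a\<close> is the greatest element of the image, so the
  image generates the same normal set as that single element.\<close>

lemma (in modal_FL_algebra) closure_bang_down:
  assumes "a \<in> carrier L"
  shows "closure L (bang L ` down L a) = down L (bang L a)"
proof
  have *: "bang L ` down L a \<subseteq> down L (bang L a)"
    using assms by (auto simp: down_def bang_mono)
  moreover have "bang L ` down L a \<subseteq> carrier L"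
    by (auto simp: down_def)
  ultimately show "closure L (bang L ` down L a) \<subseteq> down L (bang L a)"
    using assms by (simp add: closure_subset_iff down_in_normal_sets)
  have "{bang L a} \<subseteq> bang L ` down L a"
    using assms by (auto simp: down_def)
  then show "down L (bang L a) \<subseteq> closure L (bang L ` down L a)"
    using assms by (simp add: down_eq_closure closure_mono)
qed

text \<open>\<open>!\<close> is extended from below and \<open>?\<close> from above; extending \<open>?\<close> from below may lose
  its idempotence (c3). The operations of \<open>M\<close> matter only on normal sets, so that \<open>M\<close> may also be
  the algebra of propositions of a cover system.\<close>

locale MacNeille_completion = modal_FL_algebra L for L (structure) +
  fixes M :: "'a set modal_FL_algebra"
  assumes carrier_M: "carrier M = normal_sets L"
    and eq_M: "eq M = (=)"
    and le_M: "le M = (\<subseteq>)"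
    and tensor_M: "\<lbrakk>X \<in> normal_sets L; Y \<in> normal_sets L\<rbrakk>
        \<Longrightarrow> X \<odot>\<^bsub>M\<^esub> Y = closure L (X <#>\<^bsub>tensor_monoid L\<^esub> Y)"
    and unit_M: "unit M = down L (unit L)"
    and lres_M: "\<lbrakk>X \<in> normal_sets L; Y \<in> normal_sets L\<rbrakk>
        \<Longrightarrow> X \<Rightarrow>\<^sub>l\<^bsub>M\<^esub> Y = {z \<in> carrier L. \<forall>x\<in>X. z \<odot> x \<in> Y}"
    and rres_M: "\<lbrakk>X \<in> normal_sets L; Y \<in> normal_sets L\<rbrakk>
        \<Longrightarrow> X \<Rightarrow>\<^sub>r\<^bsub>M\<^esub> Y = {z \<in> carrier L. \<forall>x\<in>X. x \<odot> z \<in> Y}"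
    and falsum_M: "falsum M = down L (falsum L)"
    and bang_M: "X \<in> normal_sets L \<Longrightarrow> bang M X = closure L (bang L ` X)"
    and quest_M: "X \<in> normal_sets L \<Longrightarrow>
        quest M X = {w \<in> carrier L. \<forall>b\<in>carrier L. (\<forall>x\<in>X. x \<sqsubseteq> b) \<longrightarrow> w \<sqsubseteq> quest L b}"
begin

section \<open>The completion as a complete residuated lattice\<close>

lemma complete_lattice_M: "complete_lattice M"
proof -
  interpret M: partial_order M
    by unfold_locales (auto simp: eq_M le_M)
  show ?thesis
  proof
    fix \<X> assume "\<X> \<subseteq> carrier M"
    then have \<X>: "\<X> \<subseteq> normal_sets L"
      by (simp add: carrier_M)
    then have sub: "\<Union>\<X> \<subseteq> carrier L"
      by (auto dest: normal_setsD)
    have "is_lub M (closure L (\<Union>\<X>)) \<X>"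
      using \<X> sub subset_closure [OF sub]
      by (intro least_UpperI)
        (auto simp: carrier_M le_M closure_in_normal_sets closure_subset_iff Upper_def)
    then show "\<exists>X. is_lub M X \<X>" ..
    have "is_glb M (carrier L \<inter> \<Inter>\<X>) \<X>"
      using \<X> Inter_normal_sets [OF \<X>]
      by (intro greatest_LowerI) (auto simp: carrier_M le_M Lower_def dest: normal_setsD)
    then show "\<exists>X. is_glb M X \<X>" ..
  qed
qed

text \<open>The set is an intersection of principal down-sets, namely those of the residuals
  \<open>x \<Rightarrow>\<^sub>l u\<close> with \<open>x\<close> in \<open>X\<close> and
  \<open>u\<close> an upper bound of \<open>Y\<close>, because membership in the normal set
  \<open>Y\<close> is tested against such \<open>u\<close>.\<close>

lemma lres_normal:
  assumes X: "X \<in> normal_sets L" and Y: "Y \<in> normal_sets L"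
  shows "{z \<in> carrier L. \<forall>x\<in>X. z \<odot> x \<in> Y} \<in> normal_sets L"
proof (rule normal_setsI)
  fix z assume z: "z \<in> carrier L" "\<And>u. \<lbrakk>u \<in> carrier L; \<And>y. y \<in> {z \<in> carrier L. \<forall>x\<in>X. z \<odot> x \<in> Y} \<Longrightarrow> y \<sqsubseteq> u\<rbrakk> \<Longrightarrow> z \<sqsubseteq> u"
  have "z \<odot> x \<in> Y" if "x \<in> X" for x
  proof (rule normal_sets_mem [OF Y])
    have x: "x \<in> carrier L" using X that by (rule normal_setsD)
    then show "z \<odot> x \<in> carrier L" using z by simp
    fix u assume "u \<in> carrier L" "\<And>y. y \<in> Y \<Longrightarrow> y \<sqsubseteq> u"
    then show "z \<odot> x \<sqsubseteq> u"
      using z(1) z(2) [of "x \<Rightarrow>\<^sub>l u"] x that by (simp add: lres)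
  qed
  then show "z \<in> {z \<in> carrier L. \<forall>x\<in>X. z \<odot> x \<in> Y}"
    using z by simp
qed auto

lemma rres_normal:
  assumes X: "X \<in> normal_sets L" and Y: "Y \<in> normal_sets L"
  shows "{z \<in> carrier L. \<forall>x\<in>X. x \<odot> z \<in> Y} \<in> normal_sets L"
proof (rule normal_setsI)
  fix z assume z: "z \<in> carrier L" "\<And>u. \<lbrakk>u \<in> carrier L; \<And>y. y \<in> {z \<in> carrier L. \<forall>x\<in>X. x \<odot> z \<in> Y} \<Longrightarrow> y \<sqsubseteq> u\<rbrakk> \<Longrightarrow> z \<sqsubseteq> u"
  have "x \<odot> z \<in> Y" if "x \<in> X" for x
  proof (rule normal_sets_mem [OF Y])
    have x: "x \<in> carrier L" using X that by (rule normal_setsD)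
    then show "x \<odot> z \<in> carrier L" using z by simp
    fix u assume "u \<in> carrier L" "\<And>y. y \<in> Y \<Longrightarrow> y \<sqsubseteq> u"
    then show "x \<odot> z \<sqsubseteq> u"
      using z(1) z(2) [of "x \<Rightarrow>\<^sub>r u"] x that by (simp add: rres)
  qed
  then show "z \<in> {z \<in> carrier L. \<forall>x\<in>X. x \<odot> z \<in> Y}"
    using z by simp
qed auto

lemma quest_normal:
  "{w \<in> carrier L. \<forall>b\<in>carrier L. (\<forall>x\<in>X. x \<sqsubseteq> b) \<longrightarrow> w \<sqsubseteq> quest L b} \<in> normal_sets L"
  by (rule normal_setsI) auto

lemma tensor_M_closure:
  assumes "X \<subseteq> carrier L" "Y \<subseteq> carrier L"
  shows "closure L X \<odot>\<^bsub>M\<^esub> closure L Y = closure L (X <#>\<^bsub>tensor_monoid L\<^esub> Y)"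
  using assms by (simp add: tensor_M closure_in_normal_sets closure_tensor_closure)

lemma tensor_M_subset_iff:
  assumes "X \<in> normal_sets L" "Y \<in> normal_sets L" "Z \<in> normal_sets L"
  shows "X \<odot>\<^bsub>M\<^esub> Y \<subseteq> Z \<longleftrightarrow> (\<forall>x\<in>X. \<forall>y\<in>Y. x \<odot> y \<in> Z)"
proof -
  have "X \<odot>\<^bsub>M\<^esub> Y \<subseteq> Z \<longleftrightarrow> X <#>\<^bsub>tensor_monoid L\<^esub> Y \<subseteq> Z"
    using assms by (simp add: tensor_M closure_subset_iff tensor_set_closed normal_sets_subset)
  also have "\<dots> \<longleftrightarrow> (\<forall>x\<in>X. \<forall>y\<in>Y. x \<odot> y \<in> Z)"
    by (auto simp: set_mult_def tensor_monoid_def)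
  finally show ?thesis .
qed

lemma tensor_M_closed:
  "\<lbrakk>X \<in> normal_sets L; Y \<in> normal_sets L\<rbrakk> \<Longrightarrow> X \<odot>\<^bsub>M\<^esub> Y \<in> normal_sets L"
  by (simp add: tensor_M closure_in_normal_sets tensor_set_closed normal_sets_subset)

lemma tensor_M_assoc:
  assumes "X \<in> normal_sets L" "Y \<in> normal_sets L" "Z \<in> normal_sets L"
  shows "(X \<odot>\<^bsub>M\<^esub> Y) \<odot>\<^bsub>M\<^esub> Z = X \<odot>\<^bsub>M\<^esub> (Y \<odot>\<^bsub>M\<^esub> Z)"
proof -
  note sub = assms [THEN normal_sets_subset]
  \<comment> \<open>The raw products of sets associate; each inner product then serves as a
    generating set in \<open>tensor_M_closure\<close>.\<close>
  have "(X <#>\<^bsub>tensor_monoid L\<^esub> Y) <#>\<^bsub>tensor_monoid L\<^esub> Z = X <#>\<^bsub>tensor_monoid L\<^esub> (Y <#>\<^bsub>tensor_monoid L\<^esub> Z)"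
    using sub by (auto 0 3 simp: set_mult_def tensor_monoid_def tensor_assoc subset_iff)
  then show ?thesis
    using tensor_M_closure [OF tensor_set_closed [OF sub(1,2)] sub(3)]
      tensor_M_closure [OF sub(1) tensor_set_closed [OF sub(2,3)]]
    by (simp add: tensor_M [symmetric] closure_normal assms)
qed

lemma tensor_M_unit:
  assumes "X \<in> normal_sets L"
  shows "X \<odot>\<^bsub>M\<^esub> unit M = X" "unit M \<odot>\<^bsub>M\<^esub> X = X"
proof -
  have sub: "X \<subseteq> carrier L" by (rule normal_sets_subset) fact
  \<comment> \<open>The singleton \<open>{unit L}\<close> generates \<open>unit M\<close>, so the
    unit laws are checked on it alone.\<close>
  have "X <#>\<^bsub>tensor_monoid L\<^esub> {unit L} = X" "{unit L} <#>\<^bsub>tensor_monoid L\<^esub> X = X"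
    using sub by (auto simp: set_mult_def tensor_monoid_def subset_iff)
  then show "X \<odot>\<^bsub>M\<^esub> unit M = X" "unit M \<odot>\<^bsub>M\<^esub> X = X"
    using tensor_M_closure [OF sub, of "{unit L}"] tensor_M_closure [OF _ sub, of "{unit L}"]
    by (simp_all add: unit_M down_eq_closure closure_normal assms)
qed

lemma residuated_lattice_M: "residuated_lattice M"
proof -
  interpret M: complete_lattice M by (rule complete_lattice_M)
  interpret monoid "tensor_monoid M"
    by unfold_locales
      (simp_all add: tensor_monoid_def carrier_M tensor_M_closed tensor_M_assoc tensor_M_unit,
        simp add: unit_M down_in_normal_sets)
  show ?thesis
  proof
    fix X X' Y Y'
    assume "X \<in> carrier M" "X' \<in> carrier M" "Y \<in> carrier M" "Y' \<in> carrier M"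
      "X \<sqsubseteq>\<^bsub>M\<^esub> X'" "Y \<sqsubseteq>\<^bsub>M\<^esub> Y'"
    then show "X \<odot>\<^bsub>M\<^esub> Y \<sqsubseteq>\<^bsub>M\<^esub> X' \<odot>\<^bsub>M\<^esub> Y'"
      by (simp add: carrier_M le_M tensor_M closure_mono mono_set_mult)
  next
    fix X Y assume "X \<in> carrier M" "Y \<in> carrier M"
    then show "X \<Rightarrow>\<^sub>l\<^bsub>M\<^esub> Y \<in> carrier M" "X \<Rightarrow>\<^sub>r\<^bsub>M\<^esub> Y \<in> carrier M"
      by (simp_all add: carrier_M lres_M rres_M lres_normal rres_normal)
  next
    fix X Y Z assume "X \<in> carrier M" "Y \<in> carrier M" "Z \<in> carrier M"
    then show "X \<sqsubseteq>\<^bsub>M\<^esub> (Y \<Rightarrow>\<^sub>l\<^bsub>M\<^esub> Z) \<longleftrightarrow> X \<odot>\<^bsub>M\<^esub> Y \<sqsubseteq>\<^bsub>M\<^esub> Z"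
      "Y \<sqsubseteq>\<^bsub>M\<^esub> (X \<Rightarrow>\<^sub>r\<^bsub>M\<^esub> Z) \<longleftrightarrow> X \<odot>\<^bsub>M\<^esub> Y \<sqsubseteq>\<^bsub>M\<^esub> Z"
      by (auto simp: carrier_M le_M tensor_M_subset_iff lres_M rres_M dest: normal_setsD)
  qed
qed

section \<open>Modalities of the completion\<close>

lemma meet_M:
  assumes "X \<in> normal_sets L" "Y \<in> normal_sets L"
  shows "X \<sqinter>\<^bsub>M\<^esub> Y = X \<inter> Y"
proof -
  interpret M: complete_lattice M by (rule complete_lattice_M)
  have "X \<inter> Y \<in> normal_sets L"
    using Inter_normal_sets [of "{X, Y}"] normal_sets_subset assms by (simp add: Int_absorb1 le_infI1)
  then have "is_glb M (X \<inter> Y) {X, Y}"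
    using assms by (intro greatest_LowerI) (auto simp: carrier_M le_M Lower_def)
  moreover have "is_glb M (X \<sqinter>\<^bsub>M\<^esub> Y) {X, Y}"
    using assms by (simp add: M.inf_of_two_greatest meet_def carrier_M)
  ultimately show ?thesis
    by (rule M.greatest_unique [symmetric])
qed

lemma bang_image_closed: "X \<in> normal_sets L \<Longrightarrow> bang L ` X \<subseteq> carrier L"
  by (auto dest: normal_setsD)

lemma bang_M_closed: "X \<in> normal_sets L \<Longrightarrow> bang M X \<in> normal_sets L"
  by (simp add: bang_M closure_in_normal_sets bang_image_closed)

lemma quest_M_closed: "X \<in> normal_sets L \<Longrightarrow> quest M X \<in> normal_sets L"
  by (simp add: quest_M quest_normal)

lemma bang_M_subset_iff:
  "\<lbrakk>X \<in> normal_sets L; Y \<in> normal_sets L\<rbrakk> \<Longrightarrow> bang M X \<subseteq> Y \<longleftrightarrow> (\<forall>x\<in>X. bang L x \<in> Y)"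
  by (simp only: bang_M closure_subset_iff [OF bang_image_closed] image_subset_iff)

lemma bang_mem_bang_M: "\<lbrakk>X \<in> normal_sets L; x \<in> X\<rbrakk> \<Longrightarrow> bang L x \<in> bang M X"
  using bang_M_subset_iff bang_M_closed by blast

text \<open>The generating sets already agree: by (s4) the product of \<open>bang L x\<close> and
  \<open>bang L y\<close> is the image of \<open>x \<sqinter> y\<close>, which is in both
  down-closed sets, and conversely every \<open>bang L x\<close> is its own square.\<close>

lemma bang_M_meet:
  assumes X: "X \<in> normal_sets L" and Y: "Y \<in> normal_sets L"
  shows "bang M (X \<inter> Y) = bang M X \<odot>\<^bsub>M\<^esub> bang M Y"
proof -
  have "bang L ` X <#>\<^bsub>tensor_monoid L\<^esub> bang L ` Y = bang L ` (X \<inter> Y)"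
  proof -
    have "bang L x \<odot> bang L y \<in> bang L ` (X \<inter> Y)" if "x \<in> X" "y \<in> Y" for x y
    proof -
      have c: "x \<in> carrier L" "y \<in> carrier L"
        using that normal_setsD X Y by auto
      then have "x \<sqinter> y \<in> X \<inter> Y"
        using that normal_sets_down_closed [OF X, of x] normal_sets_down_closed [OF Y, of y]
          meet_left meet_right by simp
      then show ?thesis
        using s4 [OF c] by (metis imageI)
    qed
    moreover have "\<exists>y\<in>X. \<exists>z\<in>Y. bang L x = bang L y \<odot> bang L z" if "x \<in> X" "x \<in> Y" for x
      using that bang_tensor_bang [of x] normal_setsD [OF X] by metis
    ultimately show ?thesis
      by (auto simp: set_mult_def tensor_monoid_def)
  qed
  moreover have "X \<inter> Y \<in> normal_sets L"
    using Inter_normal_sets [of "{X, Y}"] normal_sets_subset X Y by (simp add: Int_absorb1 le_infI1)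
  ultimately show ?thesis
    using assms by (simp add: bang_M tensor_M_closure bang_image_closed)
qed

lemma bang_M_central:
  assumes X: "X \<in> normal_sets L" and Y: "Y \<in> normal_sets L"
  shows "bang M X \<odot>\<^bsub>M\<^esub> Y = Y \<odot>\<^bsub>M\<^esub> bang M X"
proof -
  have "bang L ` X <#>\<^bsub>tensor_monoid L\<^esub> Y = Y <#>\<^bsub>tensor_monoid L\<^esub> bang L ` X"
    using normal_setsD [OF X] normal_setsD [OF Y]
    by (auto 0 3 simp: set_mult_def tensor_monoid_def s5)
  then show ?thesis
    using tensor_M_closure [of "bang L ` X" Y] tensor_M_closure [of Y "bang L ` X"] assms
    by (simp add: bang_M closure_normal bang_image_closed normal_sets_subset)
qed

lemma bang_M_lres:
  assumes X: "X \<in> normal_sets L" and Y: "Y \<in> normal_sets L"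
  shows "bang M (X \<Rightarrow>\<^sub>l\<^bsub>M\<^esub> Y) \<subseteq> quest M X \<Rightarrow>\<^sub>l\<^bsub>M\<^esub> quest M Y"
proof -
  have "bang L z \<odot> w \<in> quest M Y" if z: "z \<in> X \<Rightarrow>\<^sub>l\<^bsub>M\<^esub> Y" and w: "w \<in> quest M X" for z w
  proof -
    have zc: "z \<in> carrier L" and wc: "w \<in> carrier L"
      using z w assms by (simp_all add: lres_M quest_M)
    have "bang L z \<odot> w \<sqsubseteq> quest L b" if b: "b \<in> carrier L" "\<forall>y\<in>Y. y \<sqsubseteq> b" for b
    proof -
      \<comment> \<open>If \<open>b\<close> bounds \<open>Y\<close>, then
        \<open>z \<Rightarrow>\<^sub>r b\<close> bounds \<open>X\<close>; the membership of
        \<open>w\<close> in \<open>quest M X\<close> is used at this bound. The left law in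
        \<open>M\<close> thus rests on the right residual in \<open>L\<close>.\<close>
      have "x \<sqsubseteq> z \<Rightarrow>\<^sub>r b" if "x \<in> X" for x
        using that z b normal_setsD [OF X] by (simp add: rres lres_M X Y)
      then show ?thesis
        using w b zc wc by (intro bang_tensor_quest) (simp_all add: quest_M X)
    qed
    then show ?thesis
      using zc wc by (simp add: quest_M Y)
  qed
  then show ?thesis
    using assms bang_M_subset_iff [of "X \<Rightarrow>\<^sub>l\<^bsub>M\<^esub> Y" "quest M X \<Rightarrow>\<^sub>l\<^bsub>M\<^esub> quest M Y"]
    by (auto simp: lres_M lres_normal quest_M_closed)
qed

lemma bang_M_rres:
  assumes X: "X \<in> normal_sets L" and Y: "Y \<in> normal_sets L"
  shows "bang M (X \<Rightarrow>\<^sub>r\<^bsub>M\<^esub> Y) \<subseteq> quest M X \<Rightarrow>\<^sub>r\<^bsub>M\<^esub> quest M Y"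
proof -
  have "w \<odot> bang L z \<in> quest M Y" if z: "z \<in> X \<Rightarrow>\<^sub>r\<^bsub>M\<^esub> Y" and w: "w \<in> quest M X" for z w
  proof -
    have zc: "z \<in> carrier L" and wc: "w \<in> carrier L"
      using z w assms by (simp_all add: rres_M quest_M)
    have "w \<odot> bang L z \<sqsubseteq> quest L b" if b: "b \<in> carrier L" "\<forall>y\<in>Y. y \<sqsubseteq> b" for b
    proof -
      have "x \<sqsubseteq> z \<Rightarrow>\<^sub>l b" if "x \<in> X" for x
        using that z b normal_setsD [OF X] by (simp add: lres rres_M X Y)
      then show ?thesis
        using w b zc wc by (intro tensor_quest_bang) (simp_all add: quest_M X)
    qed
    then show ?thesis
      using zc wc by (simp add: quest_M Y)
  qed
  then show ?thesis
    using assms bang_M_subset_iff [of "X \<Rightarrow>\<^sub>r\<^bsub>M\<^esub> Y" "quest M X \<Rightarrow>\<^sub>r\<^bsub>M\<^esub> quest M Y"]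
    by (auto simp: rres_M rres_normal quest_M_closed)
qed

text \<open>Among the upper bounds of \<open>down L a\<close> the least is \<open>a\<close> itself,
  and by monotonicity of \<open>quest L\<close> it gives the strongest condition.\<close>

lemma quest_M_down:
  assumes "a \<in> carrier L"
  shows "quest M (down L a) = down L (quest L a)"
proof -
  have "w \<sqsubseteq> quest L b" if "w \<in> carrier L" "w \<sqsubseteq> quest L a" "b \<in> carrier L" "a \<sqsubseteq> b" for w b
    using that assms quest_mono [of a b] le_trans [of w "quest L a" "quest L b"] by simp
  moreover have "(\<forall>x\<in>down L a. x \<sqsubseteq> b) \<longleftrightarrow> a \<sqsubseteq> b" if "b \<in> carrier L" for b
    using that assms by (auto simp: down_def intro: le_trans)
  ultimately show ?thesis
    using assms by (auto simp: quest_M down_in_normal_sets) (auto simp: down_def)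
qed

lemma bang_M_down: "a \<in> carrier L \<Longrightarrow> bang M (down L a) = down L (bang L a)"
  by (simp add: bang_M down_in_normal_sets closure_bang_down)

text \<open>If \<open>b\<close> bounds \<open>X\<close>, then \<open>quest L b\<close> bounds
  \<open>quest M X\<close> by construction, and a second \<open>quest L\<close> leaves
  \<open>quest L b\<close> unchanged. This is the gain from extending \<open>?\<close> from
  above.\<close>

lemma quest_M_quest_M:
  assumes X: "X \<in> normal_sets L"
  shows "quest M (quest M X) \<subseteq> quest M X"
proof
  fix w assume "w \<in> quest M (quest M X)"
  then have w: "w \<in> carrier L"
    and le: "\<And>c. \<lbrakk>c \<in> carrier L; \<forall>v\<in>quest M X. v \<sqsubseteq> c\<rbrakk> \<Longrightarrow> w \<sqsubseteq> quest L c"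
    by (simp_all add: quest_M [OF quest_M_closed [OF X]])
  have "w \<sqsubseteq> quest L b" if "b \<in> carrier L" "\<forall>x\<in>X. x \<sqsubseteq> b" for b
    using le [of "quest L b"] that by (simp add: quest_idem quest_M X)
  then show "w \<in> quest M X"
    using w by (simp add: quest_M X)
qed

lemma modal_FL_algebra_M: "modal_FL_algebra M"
proof -
  interpret M: complete_lattice M by (rule complete_lattice_M)
  interpret M: residuated_lattice M by (rule residuated_lattice_M)
  show ?thesis
  proof
    show "falsum M \<in> carrier M"
      by (simp add: carrier_M falsum_M down_in_normal_sets)
    show "bang M (unit M) = unit M"
      by (simp add: unit_M bang_M_down s3)
    show "quest M (falsum M) \<sqsubseteq>\<^bsub>M\<^esub> falsum M"
      by (simp add: falsum_M quest_M_down le_M down_subset_iff c4)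
  next
    fix X assume "X \<in> carrier M"
    then have X: "X \<in> normal_sets L" by (simp add: carrier_M)
    note XD = normal_setsD [OF X]
    show "bang M X \<in> carrier M" "quest M X \<in> carrier M"
      by (simp_all add: carrier_M bang_M_closed quest_M_closed X)
    show "bang M X \<sqsubseteq>\<^bsub>M\<^esub> X"
      by (simp add: le_M bang_M_subset_iff X bang_mem_normal)
    \<comment> \<open>Two uses of \<open>bang_mem_bang_M\<close> place
      \<open>bang L (bang L x)\<close> in the set, and idempotence collapses it to
      \<open>bang L x\<close>.\<close>
    have "bang L x \<in> bang M (bang M X)" if "x \<in> X" for x
      using bang_mem_bang_M [OF bang_M_closed [OF X] bang_mem_bang_M [OF X that]] bang_idem XD that
      by simp
    then show "bang M X \<sqsubseteq>\<^bsub>M\<^esub> bang M (bang M X)"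
      by (simp add: le_M bang_M_subset_iff X bang_M_closed)
    show "X \<sqsubseteq>\<^bsub>M\<^esub> quest M X"
    proof -
      have "x \<sqsubseteq> quest L b" if "x \<in> X" "b \<in> carrier L" "\<forall>x\<in>X. x \<sqsubseteq> b" for x b
        using that c2 [of b] le_trans [of x b "quest L b"] XD by simp
      then show ?thesis
        using XD by (auto simp: le_M quest_M X)
    qed
    show "quest M (quest M X) \<sqsubseteq>\<^bsub>M\<^esub> quest M X"
      by (simp add: le_M quest_M_quest_M X)
    show "falsum M \<sqsubseteq>\<^bsub>M\<^esub> quest M X"
    proof -
      have "x \<sqsubseteq> quest L b" if "x \<in> carrier L" "x \<sqsubseteq> falsum L" "b \<in> carrier L" for x b
        using that c5 [of b] le_trans [of x "falsum L" "quest L b"] by simp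
      then show ?thesis
        by (auto simp: le_M falsum_M down_def quest_M X)
    qed
  next
    fix X Y assume "X \<in> carrier M" "Y \<in> carrier M"
    then have XY: "X \<in> normal_sets L" "Y \<in> normal_sets L" by (simp_all add: carrier_M)
    then show "bang M (X \<sqinter>\<^bsub>M\<^esub> Y) = bang M X \<odot>\<^bsub>M\<^esub> bang M Y"
      by (simp add: meet_M bang_M_meet)
    show "bang M X \<odot>\<^bsub>M\<^esub> Y = Y \<odot>\<^bsub>M\<^esub> bang M X"
      using XY by (rule bang_M_central)
    show "bang M (X \<Rightarrow>\<^sub>l\<^bsub>M\<^esub> Y) \<sqsubseteq>\<^bsub>M\<^esub> (quest M X \<Rightarrow>\<^sub>l\<^bsub>M\<^esub> quest M Y)"
      "bang M (X \<Rightarrow>\<^sub>r\<^bsub>M\<^esub> Y) \<sqsubseteq>\<^bsub>M\<^esub> (quest M X \<Rightarrow>\<^sub>r\<^bsub>M\<^esub> quest M Y)"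
      using XY by (simp_all add: le_M bang_M_lres bang_M_rres)
  qed
qed

section \<open>The embedding by principal down-sets\<close>

lemma down_closed: "down L \<in> carrier L \<rightarrow> carrier M"
  by (simp add: carrier_M down_in_normal_sets)

text \<open>Normality is decisive: if a normal set \<open>Y\<close> contains \<open>A\<close>, then
  every upper bound of \<open>Y\<close> bounds \<open>A\<close> and so lies above the join
  \<open>a\<close>, which puts \<open>a\<close> into \<open>Y\<close>. Arbitrary down-sets would
  lose existing joins.\<close>

lemma down_preserves_joins: "preserves_joins L M (down L)"
  unfolding preserves_joins_def
proof (intro allI impI)
  fix A a assume A: "A \<subseteq> carrier L" and a: "is_lub L a A"
  then have ac: "a \<in> carrier L" by blast
  have sub: "down L ` A \<subseteq> carrier M"
    using A down_closed by auto
  have least: "down L a \<subseteq> Y" if "Y \<in> normal_sets L" "\<forall>x\<in>A. down L x \<subseteq> Y" for Y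
  proof -
    have "A \<subseteq> Y"
      using that A by (auto simp: down_def subset_iff)
    then have "a \<in> Y"
    proof (intro normal_sets_mem [OF that(1) ac])
      fix u assume "u \<in> carrier L" "\<And>y. y \<in> Y \<Longrightarrow> y \<sqsubseteq> u"
      with \<open>A \<subseteq> Y\<close> show "a \<sqsubseteq> u"
        by (intro least_le [OF a] Upper_memI) auto
    qed
    then show ?thesis
      by (rule down_subset_normal [OF that(1)])
  qed
  have "down L x \<subseteq> down L a" if "x \<in> A" for x
    using least_Upper_above [OF a that A] that A ac by (intro down_subset_iff [THEN iffD2]) auto
  then show "is_lub M (down L a) (down L ` A)"
  proof (intro least_UpperI)
    fix Y assume "Y \<in> Upper M (down L ` A)"
    then have "Y \<in> normal_sets L" "\<forall>x\<in>A. down L x \<subseteq> Y"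
      using Upper_memD [OF _ _ sub] by (auto simp: Upper_def carrier_M le_M)
    then show "down L a \<sqsubseteq>\<^bsub>M\<^esub> Y"
      unfolding le_M by (rule least)
  qed (use A ac in \<open>auto simp: le_M carrier_M down_in_normal_sets\<close>)
qed

text \<open>A set contained in every \<open>down L x\<close> with \<open>x\<close> in
  \<open>A\<close> consists of lower bounds of \<open>A\<close>, hence of elements below
  \<open>a\<close>.\<close>

lemma down_preserves_meets: "preserves_meets L M (down L)"
  unfolding preserves_meets_def
proof (intro allI impI)
  fix A a assume A: "A \<subseteq> carrier L" and a: "is_glb L a A"
  then have ac: "a \<in> carrier L" by blast
  have sub: "down L ` A \<subseteq> carrier M"
    using A down_closed by auto
  have greatest: "Y \<subseteq> down L a" if "Y \<in> normal_sets L" "\<forall>x\<in>A. Y \<subseteq> down L x" for Y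
  proof
    fix y assume "y \<in> Y"
    then have "y \<in> carrier L" "\<forall>x\<in>A. y \<sqsubseteq> x"
      using that by (auto simp: down_def dest: normal_setsD)
    then show "y \<in> down L a"
      using greatest_le [OF a, of y] by (simp add: down_def Lower_memI)
  qed
  have "down L a \<subseteq> down L x" if "x \<in> A" for x
    using greatest_Lower_below [OF a that A] that A ac by (intro down_subset_iff [THEN iffD2]) auto
  then show "is_glb M (down L a) (down L ` A)"
  proof (intro greatest_LowerI)
    fix Y assume "Y \<in> Lower M (down L ` A)"
    then have "Y \<in> normal_sets L" "\<forall>x\<in>A. Y \<subseteq> down L x"
      using Lower_memD [OF _ _ sub] by (auto simp: Lower_def carrier_M le_M)
    then show "Y \<sqsubseteq>\<^bsub>M\<^esub> down L a"
      unfolding le_M by (rule greatest)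
  qed (use A ac in \<open>auto simp: le_M carrier_M down_in_normal_sets\<close>)
qed

lemma tensor_M_down:
  assumes "a \<in> carrier L" "b \<in> carrier L"
  shows "down L a \<odot>\<^bsub>M\<^esub> down L b = down L (a \<odot> b)"
proof -
  have "{a} <#>\<^bsub>tensor_monoid L\<^esub> {b} = {a \<odot> b}"
    by (simp add: set_mult_def tensor_monoid_def)
  then show ?thesis
    using assms tensor_M_closure [of "{a}" "{b}"] by (simp add: down_eq_closure)
qed

lemma lres_M_down:
  assumes "a \<in> carrier L" "b \<in> carrier L"
  shows "down L a \<Rightarrow>\<^sub>l\<^bsub>M\<^esub> down L b = down L (a \<Rightarrow>\<^sub>l b)"
proof -
  have "z \<odot> x \<sqsubseteq> b" if "z \<in> carrier L" "z \<odot> a \<sqsubseteq> b" "x \<in> carrier L" "x \<sqsubseteq> a" for z x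
    using that assms tensor_mono [of z z x a] le_trans [of "z \<odot> x" "z \<odot> a" b] by simp
  then show ?thesis
    using assms by (auto simp: lres_M down_in_normal_sets) (auto simp: down_def lres)
qed

lemma rres_M_down:
  assumes "a \<in> carrier L" "b \<in> carrier L"
  shows "down L a \<Rightarrow>\<^sub>r\<^bsub>M\<^esub> down L b = down L (a \<Rightarrow>\<^sub>r b)"
proof -
  have "x \<odot> z \<sqsubseteq> b" if "z \<in> carrier L" "a \<odot> z \<sqsubseteq> b" "x \<in> carrier L" "x \<sqsubseteq> a" for z x
    using that assms tensor_mono [of x a z z] le_trans [of "x \<odot> z" "a \<odot> z" b] by simp
  then show ?thesis
    using assms by (auto simp: rres_M down_in_normal_sets) (auto simp: down_def rres)
qed

lemma down_hom: "down L \<in> modal_FL_hom L M"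
  by (rule modal_FL_hom_if_preserves)
    (simp_all add: modal_FL_algebra_axioms modal_FL_algebra_M down_closed down_preserves_joins
      down_preserves_meets tensor_M_down lres_M_down rres_M_down bang_M_down quest_M_down
      unit_M falsum_M)

end

definition MacNeille :: "('a, 'm) modal_FL_algebra_scheme \<Rightarrow> 'a set modal_FL_algebra" where
  "MacNeille L =
     \<lparr>carrier = normal_sets L,
      eq = (=),
      le = (\<subseteq>),
      tensor = (\<lambda>X Y. closure L (X <#>\<^bsub>tensor_monoid L\<^esub> Y)),
      unit = down L (unit L),
      lres = (\<lambda>X Y. {z \<in> carrier L. \<forall>x\<in>X. z \<odot>\<^bsub>L\<^esub> x \<in> Y}),
      rres = (\<lambda>X Y. {z \<in> carrier L. \<forall>x\<in>X. x \<odot>\<^bsub>L\<^esub> z \<in> Y}),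
      falsum = down L (falsum L),
      bang = (\<lambda>X. closure L (bang L ` X)),
      quest = (\<lambda>X. {w \<in> carrier L. \<forall>b\<in>carrier L.
        (\<forall>x\<in>X. x \<sqsubseteq>\<^bsub>L\<^esub> b) \<longrightarrow> w \<sqsubseteq>\<^bsub>L\<^esub> quest L b})\<rparr>"

lemma (in modal_FL_algebra) MacNeille: "MacNeille_completion L (MacNeille L)"
  by unfold_locales (simp_all add: MacNeille_def)

section \<open>Cover systems\<close>

context cover_system
begin

lemma j_mono: "X \<subseteq> Y \<Longrightarrow> j S X \<subseteq> j S Y"
  by (auto simp: j_def)

lemma subset_j:
  assumes "X \<subseteq> carrier S" "upset S X = X"
  shows "X \<subseteq> j S X"
proof
  fix x assume x: "x \<in> X"
  then obtain C where "(x, C) \<in> covers S" "C \<subseteq> upset S {x}"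
    using existence assms by blast
  moreover have "upset S {x} \<subseteq> X"
    using x assms(2) by (auto simp: upset_def)
  ultimately show "x \<in> j S X"
    using x assms(1) by (auto simp: j_def)
qed

text \<open>Refinement makes \<open>j S X\<close> an up-set, and Transitivity makes a second
  application of \<open>j\<close> add nothing.\<close>

lemma j_in_Prop:
  assumes "X \<subseteq> carrier S" "upset S X = X"
  shows "j S X \<in> Prop S"
proof -
  have "y \<in> j S X" if xy: "(x, y) \<in> preord S" and x: "x \<in> j S X" for x y
  proof -
    obtain C where C: "(x, C) \<in> covers S" "C \<subseteq> X"
      using x by (auto simp: j_def)
    then obtain C' where "(y, C') \<in> covers S" "C' \<subseteq> upset S C"
      using refinement [OF xy] by blast
    moreover have "upset S C \<subseteq> X"
      using C(2) assms(2) by (auto simp: upset_def)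
    moreover have "y \<in> carrier S"
      using xy preorder by (auto simp: preorder_on_def)
    ultimately show ?thesis by (auto simp: j_def)
  qed
  moreover have "(x, x) \<in> preord S" if "x \<in> j S X" for x
    using that preorder by (auto simp: j_def preorder_on_def refl_on_def)
  moreover have "x \<in> j S X" if x: "x \<in> j S (j S X)" for x
  proof -
    obtain C where C: "(x, C) \<in> covers S" "C \<subseteq> j S X"
      using x by (auto simp: j_def)
    then obtain D where "\<And>y. y \<in> C \<Longrightarrow> (y, D y) \<in> covers S \<and> D y \<subseteq> X"
      unfolding j_def subset_iff mem_Collect_eq by metis
    then have "(x, \<Union>y\<in>C. D y) \<in> covers S" "(\<Union>y\<in>C. D y) \<subseteq> X"
      using transitivity [OF C(1)] by auto
    then show ?thesis
      using x by (auto simp: j_def)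
  qed
  ultimately show ?thesis
    unfolding Prop_def by (auto simp: upset_def) (auto simp: j_def)
qed

text \<open>A union of propositions is an up-set, so one application of \<open>j\<close> turns it
  into a proposition containing it; a proposition above the whole family absorbs that
  application.\<close>

lemma j_Union_lub:
  assumes "\<X> \<subseteq> Prop S"
  shows "is_lub (Prop_algebra S) (j S (\<Union>\<X>)) \<X>"
proof -
  have sub: "\<Union>\<X> \<subseteq> carrier S"
    using assms by (auto simp: Prop_def)
  have up: "upset S (\<Union>\<X>) = \<Union>\<X>"
    using assms unfolding Prop_def upset_def by blast
  have least: "j S (\<Union>\<X>) \<subseteq> Y" if "Y \<in> Prop S" "\<forall>X\<in>\<X>. X \<subseteq> Y" for Y
  proof -
    have "\<Union>\<X> \<subseteq> Y"
      using that(2) by auto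
    then have "j S (\<Union>\<X>) \<subseteq> j S Y"
      by (rule j_mono)
    also have "\<dots> \<subseteq> Y"
      using that(1) by (simp add: Prop_def)
    finally show ?thesis .
  qed
  show ?thesis
  proof (rule least_UpperI)
    fix Y assume "Y \<in> Upper (Prop_algebra S) \<X>"
    then have "Y \<in> Prop S" "\<forall>X\<in>\<X>. X \<subseteq> Y"
      using assms by (auto simp: Upper_def Prop_algebra_def)
    then show "j S (\<Union>\<X>) \<sqsubseteq>\<^bsub>Prop_algebra S\<^esub> Y"
      by (simp add: Prop_algebra_def least)
  qed (use assms subset_j [OF sub up] j_in_Prop [OF sub up] in \<open>auto simp: Prop_algebra_def\<close>)
qed

lemma Inter_glb:
  assumes "\<X> \<subseteq> Prop S"
  shows "is_glb (Prop_algebra S) (carrier S \<inter> \<Inter>\<X>) \<X>"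
proof -
  have "carrier S \<inter> \<Inter>\<X> \<in> Prop S"
  proof -
    have "j S (carrier S \<inter> \<Inter>\<X>) \<subseteq> X" if "X \<in> \<X>" for X
      using that assms j_mono [of "carrier S \<inter> \<Inter>\<X>" X] by (auto simp: Prop_def)
    then have "j S (carrier S \<inter> \<Inter>\<X>) \<subseteq> carrier S \<inter> \<Inter>\<X>"
      by (auto simp: j_def)
    moreover have "upset S (carrier S \<inter> \<Inter>\<X>) = carrier S \<inter> \<Inter>\<X>"
    proof
      show "upset S (carrier S \<inter> \<Inter>\<X>) \<subseteq> carrier S \<inter> \<Inter>\<X>"
        using assms preorder unfolding Prop_def upset_def preorder_on_def by blast
      show "carrier S \<inter> \<Inter>\<X> \<subseteq> upset S (carrier S \<inter> \<Inter>\<X>)"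
        using preorder unfolding preorder_on_def refl_on_def upset_def by blast
    qed
    ultimately show ?thesis by (simp add: Prop_def)
  qed
  then show ?thesis
    using assms by (intro greatest_LowerI) (auto simp: Prop_algebra_def Lower_def, auto simp: Prop_def)
qed

end

text \<open>In a complete algebra, \<open>x \<in> closure L C\<close> says that \<open>x\<close> lies below the join of \<open>C\<close>.\<close>

definition algebra_cover_system ::
  "('a, 'm) modal_FL_algebra_scheme \<Rightarrow> 'a modal_FL_cover_system" where
  "algebra_cover_system L =
     \<lparr>carrier = carrier L,
      mult = tensor L,
      one = unit L,
      preord = {(x, y). x \<in> carrier L \<and> y \<in> carrier L \<and> y \<sqsubseteq>\<^bsub>L\<^esub> x},
      covers = {(x, C). C \<subseteq> carrier L \<and> x \<in> closure L C},
      czero = down L (falsum L),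
      idem = bang L ` carrier L,
      access = {(x, y). x \<in> carrier L \<and> y \<in> carrier L \<and> x \<sqsubseteq>\<^bsub>L\<^esub> quest L y}\<rparr>"

section \<open>Propositions of the cover system of a complete algebra\<close>

locale complete_modal_FL_algebra = modal_FL_algebra L + complete_lattice L for L (structure)
begin

abbreviation S where "S \<equiv> algebra_cover_system L"

lemma S_simps [simp]:
  "carrier S = carrier L" "mult S = tensor L" "one S = unit L"
  "(x, y) \<in> preord S \<longleftrightarrow> x \<in> carrier L \<and> y \<in> carrier L \<and> y \<sqsubseteq> x"
  "(x, C) \<in> covers S \<longleftrightarrow> C \<subseteq> carrier L \<and> x \<in> closure L C"
  "czero S = down L (falsum L)" "idem S = bang L ` carrier L"
  "(x, y) \<in> access S \<longleftrightarrow> x \<in> carrier L \<and> y \<in> carrier L \<and> x \<sqsubseteq> quest L y"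
  by (simp_all add: algebra_cover_system_def)

lemma set_mult_S: "X <#>\<^bsub>S\<^esub> Y = X <#>\<^bsub>tensor_monoid L\<^esub> Y"
  by (simp add: set_mult_def tensor_monoid_def)

lemma upset_S: "upset S X = {y \<in> carrier L. \<exists>x\<in>X \<inter> carrier L. y \<sqsubseteq> x}"
  by (auto simp: upset_def)

lemma subset_upset_S: "X \<subseteq> carrier L \<Longrightarrow> X \<subseteq> upset S X"
  using le_refl by (fastforce simp: upset_S)

lemma upset_S_singleton: "a \<in> carrier L \<Longrightarrow> upset S {a} = down L a"
  by (auto simp: upset_S down_def)

text \<open>A superset of a cover within the carrier is again a cover, so the existence of a cover
  inside \<open>X\<close> need only be tested on \<open>X\<close> itself.\<close>

lemma j_S: "X \<subseteq> carrier L \<Longrightarrow> j S X = closure L X"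
  unfolding j_def S_simps using closure_mono [of _ X] closure_closed [of X] by blast

lemma closure_upset_S:
  assumes "X \<subseteq> carrier L"
  shows "closure L (upset S X) = closure L X"
proof
  have "upset S X \<subseteq> closure L X"
    using down_subset_normal [OF closure_in_normal_sets [OF assms]] subset_closure [OF assms]
    unfolding upset_S down_def by blast
  then show "closure L (upset S X) \<subseteq> closure L X"
    using assms by (intro closure_subset_iff [THEN iffD2] closure_in_normal_sets) (auto simp: upset_S)
  show "closure L X \<subseteq> closure L (upset S X)"
    using assms by (intro closure_mono subset_upset_S)
qed

text \<open>The preorder of \<open>S\<close> is the reversed order of \<open>L\<close>, so up-sets
  are down-sets of \<open>L\<close>, and normal sets are down-closed.\<close>

lemma Prop_S: "Prop S = normal_sets L"
proof -
  have "upset S X = X" if "X \<in> normal_sets L" for X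
    unfolding upset_S
    using normal_sets_down_closed [OF that] normal_setsD [OF that] le_refl by blast
  then show ?thesis
    by (auto simp: Prop_def j_S normal_sets_def)
qed

text \<open>By completeness \<open>X\<close> has a greatest element \<open>a\<close>. It is at once
  the best witness for \<open>access\<close> and the least upper bound of \<open>X\<close>, so both
  sides amount to \<open>w \<sqsubseteq> quest L a\<close>.\<close>

lemma diamond_S:
  assumes X: "X \<in> normal_sets L"
  shows "diamond S X = {w \<in> carrier L. \<forall>b\<in>carrier L. (\<forall>x\<in>X. x \<sqsubseteq> b) \<longrightarrow> w \<sqsubseteq> quest L b}"
proof -
  obtain a where a: "a \<in> carrier L" "X = down L a"
    using X by (rule normal_set_eq_down)
  have "w \<sqsubseteq> quest L b"
    if "w \<in> carrier L" "y \<in> carrier L" "w \<sqsubseteq> quest L y" "b \<in> carrier L" "y \<sqsubseteq> b" for w y b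
    using that quest_mono [of y b] le_trans [of w "quest L y" "quest L b"] by simp
  then have "diamond S X \<subseteq> {w \<in> carrier L. \<forall>b\<in>carrier L. (\<forall>x\<in>X. x \<sqsubseteq> b) \<longrightarrow> w \<sqsubseteq> quest L b}"
    unfolding diamond_def S_simps by blast
  moreover have "a \<in> X" "\<forall>x\<in>X. x \<sqsubseteq> a"
    using a by (auto simp: down_def)
  then have "{w \<in> carrier L. \<forall>b\<in>carrier L. (\<forall>x\<in>X. x \<sqsubseteq> b) \<longrightarrow> w \<sqsubseteq> quest L b} \<subseteq> diamond S X"
    using a(1) by (auto simp: diamond_def)
  ultimately show ?thesis
    by (rule equalityI)
qed

text \<open>An element of \<open>X\<close> of the form \<open>bang L a\<close> is its own image
  under \<open>bang L\<close>; conversely \<open>bang L\<close> keeps the down-closed set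
  \<open>X\<close> within itself.\<close>

lemma bang_image_eq:
  assumes X: "X \<in> normal_sets L"
  shows "X \<inter> idem S = bang L ` X"
proof -
  have "bang L a \<in> X" if "a \<in> X" for a
    using X that by (rule bang_mem_normal)
  moreover have "bang L a \<in> bang L ` X" if "a \<in> carrier L" "bang L a \<in> X" for a
    using that bang_idem by (metis imageI)
  ultimately show ?thesis
    using normal_setsD [OF X] by auto
qed

text \<open>This identification transfers the modal FL-algebra laws and the principal embedding to
  the algebra of propositions, with no separate verification.\<close>

lemma MacNeille_Prop_algebra: "MacNeille_completion L (Prop_algebra S)"
proof
  fix X Y assume XY: "X \<in> normal_sets L" "Y \<in> normal_sets L"
  then have sub: "X <#>\<^bsub>tensor_monoid L\<^esub> Y \<subseteq> carrier L"
    by (simp add: tensor_set_closed normal_sets_subset)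
  show "X \<odot>\<^bsub>Prop_algebra S\<^esub> Y = closure L (X <#>\<^bsub>tensor_monoid L\<^esub> Y)"
    using sub closure_upset_S [OF sub] j_S [of "upset S (X <#>\<^bsub>tensor_monoid L\<^esub> Y)"]
    by (auto simp: Prop_algebra_def set_mult_S upset_S)
  show "X \<Rightarrow>\<^sub>l\<^bsub>Prop_algebra S\<^esub> Y = {z \<in> carrier L. \<forall>x\<in>X. z \<odot> x \<in> Y}"
    "X \<Rightarrow>\<^sub>r\<^bsub>Prop_algebra S\<^esub> Y = {z \<in> carrier L. \<forall>x\<in>X. x \<odot> z \<in> Y}"
    by (auto simp: Prop_algebra_def l_coset_def r_coset_def)
next
  fix X assume X: "X \<in> normal_sets L"
  have sub: "bang L ` X \<subseteq> carrier L"
    using normal_setsD [OF X] by auto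
  then show "bang (Prop_algebra S) X = closure L (bang L ` X)"
    using bang_image_eq [OF X] closure_upset_S [OF sub] j_S [of "upset S (bang L ` X)"]
    by (auto simp: Prop_algebra_def upset_S)
  show "quest (Prop_algebra S) X =
      {w \<in> carrier L. \<forall>b\<in>carrier L. (\<forall>x\<in>X. x \<sqsubseteq> b) \<longrightarrow> w \<sqsubseteq> quest L b}"
    using diamond_S [OF X] by (simp add: Prop_algebra_def)
qed (simp_all add: Prop_algebra_def Prop_S upset_S_singleton)

section \<open>Verification of the cover system axioms and of strength\<close>

lemma modal_FL_cover_system_S: "modal_FL_cover_system S"
proof
  show "preorder_on (carrier S) (preord S)"
    by (auto simp: preorder_on_def refl_on_def trans_def intro: le_trans)
  show "covers S \<subseteq> carrier S \<times> Pow (carrier S)"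
    using subsetD [OF closure_closed] by auto
next
  fix x assume "x \<in> carrier S"
  then show "\<exists>C. (x, C) \<in> covers S \<and> C \<subseteq> upset S {x}"
    using subset_closure [of "{x}"] by (intro exI [of _ "{x}"]) (auto simp: upset_S)
next
  fix x C D assume x: "(x, C) \<in> covers S" and D: "\<And>y. y \<in> C \<Longrightarrow> (y, D y) \<in> covers S"
  have sub: "(\<Union>y\<in>C. D y) \<subseteq> carrier L"
    using D by auto
  have "C \<subseteq> closure L (\<Union>y\<in>C. D y)"
  proof
    fix y assume y: "y \<in> C"
    then have "closure L (D y) \<subseteq> closure L (\<Union>y\<in>C. D y)"
      by (intro closure_mono) blast
    then show "y \<in> closure L (\<Union>y\<in>C. D y)"
      using D [OF y] by auto
  qed
  then have "closure L C \<subseteq> closure L (\<Union>y\<in>C. D y)"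
    using closure_subset_iff [of C] closure_in_normal_sets [OF sub] x by simp
  then show "(x, \<Union>y\<in>C. D y) \<in> covers S"
    using x sub by auto
next
  fix x y C assume "(x, y) \<in> preord S" "(x, C) \<in> covers S"
  \<comment> \<open>The cover \<open>C\<close> itself refines: \<open>y\<close> is below
    \<open>x\<close>, and closures are down-closed.\<close>
  then show "\<exists>C'. C' \<subseteq> upset S C \<and> (y, C') \<in> covers S"
    using normal_sets_down_closed [OF closure_in_normal_sets, of C x y]
    by (intro exI [of _ C]) (simp add: subset_upset_S)
next
  fix x y assume "x \<in> carrier S" "y \<in> carrier S"
  then show "x \<otimes>\<^bsub>S\<^esub> y \<in> carrier S" by simp
next
  fix x y z assume "x \<in> carrier S" "y \<in> carrier S" "z \<in> carrier S"
  then show "x \<otimes>\<^bsub>S\<^esub> y \<otimes>\<^bsub>S\<^esub> z = x \<otimes>\<^bsub>S\<^esub> (y \<otimes>\<^bsub>S\<^esub> z)"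
    by (simp add: tensor_assoc)
next
  fix x x' y y' assume "(x, x') \<in> preord S" "(y, y') \<in> preord S"
  then show "(x \<otimes>\<^bsub>S\<^esub> y, x' \<otimes>\<^bsub>S\<^esub> y') \<in> preord S"
    by (simp add: tensor_mono)
next
  fix x C y assume C: "(x, C) \<in> covers S" and y: "y \<in> carrier S"
  \<comment> \<open>A coset is a product with the singleton \<open>{y}\<close>, so both cover laws
    are instances of \<open>tensor_mem_closure\<close>.\<close>
  then have "y \<in> closure L {y}" using subset_closure [of "{y}"] by simp
  then show "(x \<otimes>\<^bsub>S\<^esub> y, C #>\<^bsub>S\<^esub> y) \<in> covers S" "(y \<otimes>\<^bsub>S\<^esub> x, y <#\<^bsub>S\<^esub> C) \<in> covers S"
    using C y tensor_mem_closure [of C "{y}" x y] tensor_mem_closure [of "{y}" C y x]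
      tensor_set_closed [of C "{y}"] tensor_set_closed [of "{y}" C]
    by (simp_all add: r_coset_eq_set_mult l_coset_eq_set_mult set_mult_S)
next
  fix x C assume x: "(x, C) \<in> covers S" and "C \<subseteq> upset S {\<one>\<^bsub>S\<^esub>}"
  \<comment> \<open>The up-set of the unit is a principal down-set of \<open>L\<close>, hence
    normal, and so contains everything that \<open>C\<close> covers.\<close>
  then have "closure L C \<subseteq> down L (unit L)"
    by (simp add: upset_S_singleton closure_subset_iff down_in_normal_sets)
  then show "(\<one>\<^bsub>S\<^esub>, x) \<in> preord S"
    using x by (auto simp: down_def)
next
  show "czero S \<in> Prop S"
    by (simp add: Prop_S down_in_normal_sets)
  show "idem S \<subseteq> upset S {\<one>\<^bsub>S\<^esub>}"
    by (auto simp: upset_S bang_le_unit)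
  have "unit L \<in> bang L ` carrier L"
    using s3 by (metis imageI unit_closed)
  moreover have "bang L ` carrier L \<subseteq> carrier L"
    by auto
  moreover from this have "bang L ` carrier L \<subseteq> closure L (bang L ` carrier L)"
    by (rule subset_closure)
  ultimately show "\<one>\<^bsub>S\<^esub> \<in> idem S" "(\<one>\<^bsub>S\<^esub>, idem S) \<in> covers S"
    by simp_all blast
next
  fix x y assume "x \<in> idem S" "y \<in> idem S"
  then show "x \<otimes>\<^bsub>S\<^esub> y \<in> idem S"
    by (auto simp: s4 [symmetric])
next
  fix x assume "x \<in> idem S"
  then show "x = x \<otimes>\<^bsub>S\<^esub> x"
    by (auto simp: bang_tensor_bang)
next
  fix x y assume "x \<in> idem S" "y \<in> carrier S"
  then show "x \<otimes>\<^bsub>S\<^esub> y = y \<otimes>\<^bsub>S\<^esub> x"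
    using s5 by auto
next
  fix x y z assume "(x, y) \<in> preord S" "(x, z) \<in> access S"
  then show "\<exists>w. (z, w) \<in> preord S \<and> (y, w) \<in> access S"
    using le_trans [of y x "quest L z"] by (intro exI [of _ z]) simp
next
  fix X x C assume X: "X \<subseteq> carrier S" and x: "(x, C) \<in> covers S" and C: "C \<subseteq> diamond S X"
  \<comment> \<open>The successor sought is the join \<open>s\<close> of \<open>X\<close>: each
    \<open>c\<close> in \<open>C\<close> is below some \<open>quest L v\<close> with
    \<open>v\<close> in \<open>X\<close>, hence below \<open>quest L s\<close>, and \<open>s\<close>
    is covered by \<open>X\<close>.\<close>
  obtain s where s: "is_lub L s X"
    using sup_exists [of X] X by auto
  then have sc: "s \<in> carrier L" by blast
  have "c \<sqsubseteq> quest L s" if c: "c \<in> C" for c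
  proof -
    obtain v where v: "c \<in> carrier L" "v \<in> X" "v \<in> carrier L" "c \<sqsubseteq> quest L v"
      using C c by (auto simp: diamond_def)
    have "quest L v \<sqsubseteq> quest L s"
      using v sc least_Upper_above [OF s v(2)] X by (simp add: quest_mono)
    with v sc show ?thesis
      using le_trans [of c "quest L v" "quest L s"] by simp
  qed
  then have "x \<sqsubseteq> quest L s" "x \<in> carrier L"
    using x sc mem_closure_iff [of C x] by simp_all
  moreover have "s \<in> closure L X"
    using X sc least_le [OF s Upper_memI] by (simp add: mem_closure_iff)
  ultimately show "\<exists>y D. (x, y) \<in> access S \<and> (y, D) \<in> covers S \<and> D \<subseteq> X"
    using X sc by auto
next
  fix x y z assume "x \<in> idem S" and yz: "(y, z) \<in> access S"
  then obtain a where a: "a \<in> carrier L" "x = bang L a" by auto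
  \<comment> \<open>Since \<open>z\<close> lies below
    \<open>x \<Rightarrow>\<^sub>r (x \<odot> z)\<close>, monotonicity prepares
    \<open>bang_tensor_quest\<close>; there \<open>bang L x\<close> is \<open>x\<close>, as
    \<open>x\<close> is in the range of \<open>bang L\<close>. The right-hand version follows by
    centrality (s5).\<close>
  have "y \<sqsubseteq> quest L (x \<Rightarrow>\<^sub>r (x \<odot> z))"
    using a yz quest_mono [of z "x \<Rightarrow>\<^sub>r (x \<odot> z)"]
      le_trans [of y "quest L z" "quest L (x \<Rightarrow>\<^sub>r (x \<odot> z))"]
    by (simp add: rres)
  then have "x \<odot> y \<sqsubseteq> quest L (x \<odot> z)"
    using bang_tensor_quest [of x y "x \<odot> z"] a yz by (simp add: bang_idem)
  then show "(x \<otimes>\<^bsub>S\<^esub> y, x \<otimes>\<^bsub>S\<^esub> z) \<in> access S" "(y \<otimes>\<^bsub>S\<^esub> x, z \<otimes>\<^bsub>S\<^esub> x) \<in> access S"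
    using a yz by (simp_all add: s5)
next
  show "refl_on (carrier S) (access S)"
    by (auto simp: refl_on_def c2)
  show "trans (access S)"
  proof (rule transI)
    fix x y z assume "(x, y) \<in> access S" "(y, z) \<in> access S"
    then show "(x, z) \<in> access S"
      using quest_mono [of y "quest L z"] le_trans [of x "quest L y" "quest L z"]
      by (simp add: quest_idem)
  qed
next
  fix x y assume "(x, y) \<in> access S" "y \<in> czero S"
  then show "x \<in> czero S"
    using quest_mono [of y "falsum L"] c4 le_trans [of x "quest L y" "quest L (falsum L)"]
      le_trans [of x "quest L (falsum L)" "falsum L"]
    by (simp add: down_def)
next
  fix x assume "x \<in> czero S"
  \<comment> \<open>The witness is the bottom element: the empty set covers it, as it is below
    everything, and (c5) gives \<open>falsum L \<sqsubseteq> quest L \<bottom>\<close>.\<close>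
  then show "\<exists>y. (x, y) \<in> access S \<and> (y, {}) \<in> covers S"
    using c5 [of \<bottom>] le_trans [of x "falsum L" "quest L \<bottom>"]
    by (intro exI [of _ \<bottom>]) (simp add: down_def mem_closure_iff)
qed auto

text \<open>Both propositions are principal, and by monotonicity of the tensor the up-set of their
  product is the principal down-set of \<open>a \<odot> b\<close>, which is already closed.\<close>

lemma strong_S: "strong S"
  unfolding strong_def
proof (intro ballI)
  interpret M: MacNeille_completion L "Prop_algebra S"
    by (rule MacNeille_Prop_algebra)
  fix X Y assume "X \<in> Prop S" "Y \<in> Prop S"
  then obtain a b where ab: "a \<in> carrier L" "b \<in> carrier L" and XY: "X = down L a" "Y = down L b"
    unfolding Prop_S by (metis normal_set_eq_down)
  have "upset S (X <#>\<^bsub>S\<^esub> Y) = down L (a \<odot> b)"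
  proof -
    have "a \<in> X" "b \<in> Y"
      using ab XY by (auto simp: down_def)
    have "y \<sqsubseteq> a \<odot> b"
      if "y \<in> carrier L" "x \<in> carrier L" "x' \<in> carrier L" "x \<sqsubseteq> a" "x' \<sqsubseteq> b" "y \<sqsubseteq> x \<odot> x'" for y x x'
      using that ab tensor_mono [of x a x' b] le_trans [of y "x \<odot> x'" "a \<odot> b"] by simp
    then have "upset S (X <#>\<^bsub>S\<^esub> Y) \<subseteq> down L (a \<odot> b)"
      by (auto simp: XY upset_S set_mult_def down_def)
    moreover have "y \<in> upset S (X <#>\<^bsub>S\<^esub> Y)" if "y \<in> down L (a \<odot> b)" for y
      using that ab \<open>a \<in> X\<close> \<open>b \<in> Y\<close>
      by (auto simp: upset_S set_mult_def down_def intro!: bexI [of _ "a \<odot> b"])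
    ultimately show ?thesis by auto
  qed
  then show "j S (upset S (X <#>\<^bsub>S\<^esub> Y)) = upset S (X <#>\<^bsub>S\<^esub> Y)"
    using ab by (simp add: j_S normal_sets_subset down_in_normal_sets closure_normal)
qed

end

section \<open>Embedding by two successive completions\<close>

theorem theorem4:
  fixes L :: "'a modal_FL_algebra"
  assumes "modal_FL_algebra L"
  shows "\<exists>(S :: 'a set modal_FL_cover_system) f.
      modal_FL_cover_system S \<and> strong S
    \<and> modal_FL_algebra (Prop_algebra S)
    \<and> (\<forall>\<X> \<subseteq> Prop S.
          is_lub (Prop_algebra S) (j S (\<Union>\<X>)) \<X>
        \<and> is_glb (Prop_algebra S) (carrier S \<inter> \<Inter>\<X>) \<X>)
    \<and> f \<in> modal_FL_hom L (Prop_algebra S)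
    \<and> inj_on f (carrier L)
    \<and> preserves_joins L (Prop_algebra S) f
    \<and> preserves_meets L (Prop_algebra S) f"
proof -
  interpret L: modal_FL_algebra L by fact
  define M where "M = MacNeille L"
  interpret LM: MacNeille_completion L M
    unfolding M_def by (rule L.MacNeille)
  interpret M: complete_modal_FL_algebra M
    by (simp add: complete_modal_FL_algebra_def LM.modal_FL_algebra_M LM.complete_lattice_M)
  \<comment> \<open>The points of \<open>S\<close> are the normal sets of \<open>L\<close>, and its
    propositions are the normal sets of \<open>M\<close>.\<close>
  define S where "S = algebra_cover_system M"
  interpret MP: MacNeille_completion M "Prop_algebra S"
    unfolding S_def by (rule M.MacNeille_Prop_algebra)
  interpret S: modal_FL_cover_system S
    unfolding S_def by (rule M.modal_FL_cover_system_S)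
  \<comment> \<open>The inner map sends \<open>L\<close> into the complete algebra \<open>M\<close>;
    the outer one sends each point of \<open>S\<close> to the proposition it generates.\<close>
  let ?f = "down M \<circ> down L"
  have "strong S"
    unfolding S_def by (rule M.strong_S)
  moreover have "?f \<in> modal_FL_hom L (Prop_algebra S)"
    using LM.down_hom MP.down_hom by (rule modal_FL_hom_comp)
  moreover have "inj_on ?f (carrier L)"
    by (rule comp_inj_on [OF L.down_inj inj_on_subset [OF M.down_inj]]) (use LM.down_closed in auto)
  moreover have "preserves_joins L (Prop_algebra S) ?f"
    using LM.down_preserves_joins MP.down_preserves_joins LM.down_closed
    by (rule preserves_joins_comp)
  moreover have "preserves_meets L (Prop_algebra S) ?f"
    using LM.down_preserves_meets MP.down_preserves_meets LM.down_closed
    by (rule preserves_meets_comp)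
  ultimately show ?thesis
    using S.modal_FL_cover_system_axioms MP.modal_FL_algebra_M S.j_Union_lub S.Inter_glb by blast
qed

end
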